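(* For all $(p,q)\in\mathbb{C}^2$ in the region $\{\Re(p)=\Re(q)=0\}$, we have $$K(p,q)L(p,q)+u(p,q)A(p)+v(p,q)B(q)=0,$$ where the kernel $K$ is given by $$K(p,q)=\frac12\left(\sigma_1p^2+2\rho pq+\sigma_2q^2\right)+\mu_1p+\mu_2q,$$ while $u$ and $v$ are the linear functions $$u(p,q)=r_1p+q,\qquad v(p,q)=r_2q+p.$$
   Context: Let $S=\{(z_1,z_2)\in\mathbb{R}^2: z_1\ge 0\text{ or }z_2\ge 0\}$ be the three-quarter plane. Parameters: drift $\mu=(\mu_1,\mu_2)$, reflection vectors $R_1=(r_1,1)$, $R_2=(1,r_2)$, covariance matrix $\Sigma=\begin{pmatrix}\sigma_1&\rho\\ \rho&\sigma_2\end{pmatrix}$ with $\sigma_1\sigma_2-\rho^2>0$. The obliquely reflected Brownian motion $Z_t=(Z^1_t,Z^2_t)$ in $S$ is given by $$Z_t^1=Z_0^1+W_t^1+\mu_1t+r_1L_t^1+L_t^2,\qquad Z_t^2=Z_0^2+W_t^2+\mu_2t+L_t^1+r_2L_t^2,$$ where $W$ is a planar Brownian motion with covariance $\Sigma$, and $L^1$ (resp. $L^2$) is, up to a constant, the local time of $Z$ on the boundary half-line $\{z_1\le 0,z_2=0\}$ (resp. $\{z_1=0,z_2\le 0\}$). Standing assumptions: the process is positive recurrent with a unique stationary distribution (invariant probability measure) $\Pi$, which corresponds to $\mu_1<0$, $\mu_2<0$, $\mu_1-r_1\mu_2>0$, $\mu_2-r_2\mu_1>0$ (so $r_1,r_2>0$).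 The boundary invariant measures on $(-\infty,0]$ are $\nu_1(E)=\mathbb{E}_\Pi\int_0^1 1_{E\times\{0\}}(Z_s)\,dL^1_s$ and $\nu_2(E)=\mathbb{E}_\Pi\int_0^1 1_{\{0\}\times E}(Z_s)\,dL^2_s$, where $\mathbb{E}_\Pi$ is expectation when $Z_0$ has law $\Pi$. For $\Re(p)=\Re(q)=0$, the Fourier transforms are $$L(p,q)=\int_Se^{pz_1+qz_2}\,d\Pi(z_1,z_2),\quad A(p)=\int_{-\infty}^0e^{pz_1}\,d\nu_1(z_1),\quad B(q)=\int_{-\infty}^0e^{qz_2}\,d\nu_2(z_2).$$ *)

theory Defs
  imports "HOL-Probability.Probability"
begin

definition three_quarter_plane :: "(real \<times> real) set" where
  "three_quarter_plane = {z. fst z \<ge> 0 \<or> snd z \<ge> 0}"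

abbreviation tqp_space :: "(real \<times> real) measure" where
  "tqp_space \<equiv> restrict_space borel three_quarter_plane"

text \<open>Both boundary half-lines contain the corner.\<close>

definition half_line1 :: "(real \<times> real) set" where
  "half_line1 = {..0} \<times> {0}"

definition half_line2 :: "(real \<times> real) set" where
  "half_line2 = {0} \<times> {..0}"

text \<open>
  Brownian motion (without drift) started at 0, with respect to a filtration, with covariance
  matrix \<open>((\<sigma>1, \<rho>), (\<rho>, \<sigma>2))\<close>. Thus \<open>\<sigma>1\<close> and \<open>\<sigma>2\<close> are variances, whereas
  \<^const>\<open>normal_density\<close> takes a standard deviation. An increment is bivariate Gaussian in
  the sense that all its nontrivial linear combinations are Gaussian. Time is \<open>[0,\<infinity>)\<close>, here and
  below: values of the processes at negative times are irrelevant.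
\<close>

definition planar_brownian_motion ::
  "real \<Rightarrow> real \<Rightarrow> real \<Rightarrow> 'a measure \<Rightarrow> (real \<Rightarrow> 'a measure) \<Rightarrow> (real \<Rightarrow> 'a \<Rightarrow> real \<times> real) \<Rightarrow> bool"
where
  "planar_brownian_motion \<sigma>1 \<rho> \<sigma>2 P F W \<longleftrightarrow>
     (\<forall>t\<ge>0. W t \<in> borel_measurable (F t)) \<and>
     (\<forall>\<omega>\<in>space P. continuous_on {0..} (\<lambda>t. W t \<omega>)) \<and>
     (AE \<omega> in P. W 0 \<omega> = 0) \<and>
     (\<forall>s t. 0 \<le> s \<and> s < t \<longrightarrow>
        prob_space.indep_set P (sets (F s))
          (sets (vimage_algebra (space P) (\<lambda>\<omega>. W t \<omega> - W s \<omega>) borel)) \<and>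
        (\<forall>a b. (a, b) \<noteq> (0, 0) \<longrightarrow>
           distributed P lborel (\<lambda>\<omega>. a * fst (W t \<omega> - W s \<omega>) + b * snd (W t \<omega> - W s \<omega>))
             (normal_density 0 (sqrt ((t - s) * (\<sigma>1 * a\<^sup>2 + 2 * \<rho> * a * b + \<sigma>2 * b\<^sup>2))))))"

text \<open>The Lebesgue--Stieltjes measure \<open>dl\<close> of a continuous nondecreasing \<open>l\<close> on \<open>[0,\<infinity>)\<close>.\<close>

definition stieltjes :: "(real \<Rightarrow> real) \<Rightarrow> real measure" where
  "stieltjes l = interval_measure (\<lambda>t. l (max 0 t))"

text \<open>
  Local time, up to normalisation, of \<open>Z\<close> on a boundary half-line \<open>H\<close>, in the sense usual for
  reflected processes: an adapted continuous nondecreasing process started at 0 that increases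
  only when \<open>Z\<close> is in \<open>H\<close>. The normalisation is fixed by the equation of the reflected process.
\<close>

definition boundary_local_time ::
  "'a measure \<Rightarrow> (real \<Rightarrow> 'a measure) \<Rightarrow> (real \<Rightarrow> 'a \<Rightarrow> real \<times> real) \<Rightarrow> (real \<times> real) set
   \<Rightarrow> (real \<Rightarrow> 'a \<Rightarrow> real) \<Rightarrow> bool"
where
  "boundary_local_time P F Z H L \<longleftrightarrow>
     (\<forall>t\<ge>0. L t \<in> borel_measurable (F t)) \<and>
     (\<forall>\<omega>\<in>space P. continuous_on {0..} (\<lambda>t. L t \<omega>) \<and> mono_on {0..} (\<lambda>t. L t \<omega>) \<and> L 0 \<omega> = 0) \<and>
     (AE \<omega> in P. AE s in stieltjes (\<lambda>t. L t \<omega>). 0 \<le> s \<longrightarrow> Z s \<omega> \<in> H)"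

definition transition_kernel ::
  "(real \<times> real \<Rightarrow> 'a measure) \<Rightarrow> (real \<Rightarrow> 'a \<Rightarrow> real \<times> real) \<Rightarrow> real \<Rightarrow> real \<times> real
   \<Rightarrow> (real \<times> real) measure"
where
  "transition_kernel P Z t x = distr (P x) tqp_space (Z t)"

text \<open>
  The obliquely reflected Brownian motion in the three-quarter plane, as a Markov process: \<open>P x\<close>
  is the law on the sample space \<open>M\<close> under which the process starts at \<open>x\<close>.
\<close>

locale reflected_brownian_motion =
  fixes \<mu>1 \<mu>2 r1 r2 \<sigma>1 \<rho> \<sigma>2 :: real
    and M :: "'a measure"
    and F :: "real \<Rightarrow> 'a measure"
    and P :: "real \<times> real \<Rightarrow> 'a measure"
    and Z W :: "real \<Rightarrow> 'a \<Rightarrow> real \<times> real"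
    and L1 L2 :: "real \<Rightarrow> 'a \<Rightarrow> real"
  assumes subalgebra: "\<And>t. 0 \<le> t \<Longrightarrow> subalgebra M (F t)"
    and filtration: "\<And>s t. 0 \<le> s \<Longrightarrow> s \<le> t \<Longrightarrow> sets (F s) \<subseteq> sets (F t)"
    and kernel: "P \<in> measurable tqp_space (prob_algebra M)"
    and adapted: "\<And>t. 0 \<le> t \<Longrightarrow> Z t \<in> borel_measurable (F t)"
    and continuous: "\<And>\<omega>. \<omega> \<in> space M \<Longrightarrow> continuous_on {0..} (\<lambda>t. Z t \<omega>)"
    and in_tqp: "\<And>\<omega> t. \<omega> \<in> space M \<Longrightarrow> 0 \<le> t \<Longrightarrow> Z t \<omega> \<in> three_quarter_plane"
    and start: "\<And>x. x \<in> three_quarter_plane \<Longrightarrow> AE \<omega> in P x. Z 0 \<omega> = x"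
    and brownian: "\<And>x. x \<in> three_quarter_plane \<Longrightarrow> planar_brownian_motion \<sigma>1 \<rho> \<sigma>2 (P x) F W"
    and local_time1: "\<And>x. x \<in> three_quarter_plane \<Longrightarrow> boundary_local_time (P x) F Z half_line1 L1"
    and local_time2: "\<And>x. x \<in> three_quarter_plane \<Longrightarrow> boundary_local_time (P x) F Z half_line2 L2"
    and equation: "\<And>x. x \<in> three_quarter_plane \<Longrightarrow> AE \<omega> in P x. \<forall>t\<ge>0.
        fst (Z t \<omega>) = fst (Z 0 \<omega>) + fst (W t \<omega>) + \<mu>1 * t + r1 * L1 t \<omega> + L2 t \<omega> \<and>
        snd (Z t \<omega>) = snd (Z 0 \<omega>) + snd (W t \<omega>) + \<mu>2 * t + L1 t \<omega> + r2 * L2 t \<omega>"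
    and markov: "\<And>x s t A B. x \<in> three_quarter_plane \<Longrightarrow> 0 \<le> s \<Longrightarrow> 0 \<le> t \<Longrightarrow> A \<in> sets (F s) \<Longrightarrow>
        B \<in> sets tqp_space \<Longrightarrow>
        emeasure (P x) {\<omega> \<in> A. Z (s + t) \<omega> \<in> B}
          = (\<integral>\<^sup>+\<omega>\<in>A. emeasure (transition_kernel P Z t (Z s \<omega>)) B \<partial>P x)"

definition hitting_time :: "(real \<Rightarrow> 'a \<Rightarrow> real \<times> real) \<Rightarrow> (real \<times> real) set \<Rightarrow> 'a \<Rightarrow> ennreal" where
  "hitting_time Z A \<omega> = (INF t\<in>{t. 0 \<le> t \<and> Z t \<omega> \<in> A}. ennreal t)"

definition positive_recurrent ::
  "(real \<times> real \<Rightarrow> 'a measure) \<Rightarrow> (real \<Rightarrow> 'a \<Rightarrow> real \<times> real) \<Rightarrow> bool" where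
  "positive_recurrent P Z \<longleftrightarrow>
     (\<forall>x\<in>three_quarter_plane. \<forall>A\<subseteq>three_quarter_plane. closed A \<and> emeasure lborel A > 0 \<longrightarrow>
        (\<integral>\<^sup>+\<omega>. hitting_time Z A \<omega> \<partial>P x) < \<infinity>)"

definition stationary_distribution ::
  "(real \<times> real \<Rightarrow> 'a measure) \<Rightarrow> (real \<Rightarrow> 'a \<Rightarrow> real \<times> real) \<Rightarrow> (real \<times> real) measure \<Rightarrow> bool" where
  "stationary_distribution P Z \<pi> \<longleftrightarrow>
     prob_space \<pi> \<and> sets \<pi> = sets tqp_space \<and> (\<forall>t\<ge>0. \<pi> \<bind> transition_kernel P Z t = \<pi>)"

text \<open>
  In the boundary measures, \<open>\<pi> \<bind> P\<close> is the law of the process when \<open>Z 0\<close> has law \<open>\<pi>\<close>.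
\<close>

definition boundary_measure1 ::
  "(real \<times> real \<Rightarrow> 'a measure) \<Rightarrow> (real \<Rightarrow> 'a \<Rightarrow> real \<times> real) \<Rightarrow> (real \<Rightarrow> 'a \<Rightarrow> real)
   \<Rightarrow> (real \<times> real) measure \<Rightarrow> real measure"
where
  "boundary_measure1 P Z L1 \<pi> = measure_of {..0} (sets (restrict_space borel {..0}))
     (\<lambda>E. \<integral>\<^sup>+\<omega>. (\<integral>\<^sup>+s\<in>{0..1}. indicator (E \<times> {0}) (Z s \<omega>) \<partial>stieltjes (\<lambda>t. L1 t \<omega>)) \<partial>(\<pi> \<bind> P))"

definition boundary_measure2 ::
  "(real \<times> real \<Rightarrow> 'a measure) \<Rightarrow> (real \<Rightarrow> 'a \<Rightarrow> real \<times> real) \<Rightarrow> (real \<Rightarrow> 'a \<Rightarrow> real)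
   \<Rightarrow> (real \<times> real) measure \<Rightarrow> real measure"
where
  "boundary_measure2 P Z L2 \<pi> = measure_of {..0} (sets (restrict_space borel {..0}))
     (\<lambda>E. \<integral>\<^sup>+\<omega>. (\<integral>\<^sup>+s\<in>{0..1}. indicator ({0} \<times> E) (Z s \<omega>) \<partial>stieltjes (\<lambda>t. L2 t \<omega>)) \<partial>(\<pi> \<bind> P))"

definition plane_transform :: "(real \<times> real) measure \<Rightarrow> complex \<Rightarrow> complex \<Rightarrow> complex" where
  "plane_transform \<pi> p q = (\<integral>z. exp (p * of_real (fst z) + q * of_real (snd z)) \<partial>\<pi>)"

definition line_transform :: "real measure \<Rightarrow> complex \<Rightarrow> complex" where
  "line_transform \<nu> p = (\<integral>x. exp (p * of_real x) \<partial>\<nu>)"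

definition kernel_K :: "real \<Rightarrow> real \<Rightarrow> real \<Rightarrow> real \<Rightarrow> real \<Rightarrow> complex \<Rightarrow> complex \<Rightarrow> complex" where
  "kernel_K \<sigma>1 \<rho> \<sigma>2 \<mu>1 \<mu>2 p q =
     1 / 2 * (of_real \<sigma>1 * p\<^sup>2 + 2 * of_real \<rho> * p * q + of_real \<sigma>2 * q\<^sup>2)
     + of_real \<mu>1 * p + of_real \<mu>2 * q"

definition coeff_u :: "real \<Rightarrow> complex \<Rightarrow> complex \<Rightarrow> complex" where
  "coeff_u r1 p q = of_real r1 * p + q"

definition coeff_v :: "real \<Rightarrow> complex \<Rightarrow> complex \<Rightarrow> complex" where
  "coeff_v r2 p q = of_real r2 * q + p"

end

theory Submission
  imports Defs
begin

text \<open>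
  Write \<open>f z = exp (p * fst z + q * snd z)\<close>, which has modulus 1. Informally, the equation is Ito's
  formula for \<open>f (Z t)\<close> on \<open>[0, 1]\<close> in mean: stationarity makes the left-hand side vanish, the
  martingale part drops out, the second-order and drift terms contribute \<open>K\<close> times the transform of
  the stationary distribution, and each local time contributes its linear factor times the expected
  integral of \<open>f (Z s)\<close> against it, that is, a transform of a boundary measure.

  Stochastic integration can be avoided because \<open>f\<close> is an exponential. Over a time step from \<open>s\<close>
  to \<open>t\<close> let \<open>w\<close> be the push \<open>u * (L1 t - L1 s) + v * (L2 t - L2 s)\<close>. Then \<open>f (Z t) * exp (- w)\<close>
  equals \<open>f (Z s)\<close> times the exponential of an independent Gaussian increment with drift, so its mean
  is \<open>exp ((t - s) * K)\<close> times the transform of the stationary distribution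
  (\<open>expectation_fourier_push_removed\<close>). The mean of \<open>f (Z t)\<close> is that transform itself. Hence the sum
  of \<open>f (Z t) * (1 - exp (- w))\<close> over \<open>n\<close> steps of length \<open>1 / n\<close> has mean
  \<open>n * (1 - exp (K / n))\<close> times the transform, which tends to \<open>- K\<close> times it. Pathwise the same sum
  is essentially a Riemann sum and tends to \<open>u \<integral> f (Z s) dL1 + v \<integral> f (Z s) dL2\<close>
  (\<open>exponential_sums_tendsto_stieltjes\<close>).

  Two points need care. Exchanging limit and mean requires that the local times at time 1 be
  integrable under the stationary law, while the stationary distribution need not have moments a
  priori; this follows from the fact that a difference of two variables with equal laws is integrable
  as soon as its negative part is (\<open>integrable_local_times\<close>). And the boundary measures are given
  as set functions; that these are measures, with the expected integrals
  against them, rests on the measurable dependence of the local times on the path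
  (\<open>line_integral_occupation_measure\<close>).
\<close>

section \<open>Riemann sums for integrals against a continuous clock\<close>

lemma clock_continuous_mono:
  fixes l :: "real \<Rightarrow> real"
  assumes "continuous_on {0..} l" "mono_on {0..} l"
  shows "continuous_on UNIV (\<lambda>t. l (max 0 t))" "\<And>x y. x \<le> y \<Longrightarrow> l (max 0 x) \<le> l (max 0 y)"
proof -
  show "continuous_on UNIV (\<lambda>t. l (max 0 t))"
    by (rule continuous_on_compose2[OF assms(1), of UNIV "max 0"]) (auto intro!: continuous_intros continuous_on_max)
  show "l (max 0 x) \<le> l (max 0 y)" if "x \<le> y" for x y
    using that by (intro mono_onD[OF assms(2)]) auto
qed

lemma sets_stieltjes [simp, measurable_cong]: "sets (stieltjes l) = sets borel"
  by (simp add: stieltjes_def)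

lemma space_stieltjes [simp]: "space (stieltjes l) = UNIV"
  by (simp add: stieltjes_def)

lemma emeasure_stieltjes:
  assumes "continuous_on {0..} l" "mono_on {0..} l" "0 \<le> a" "a \<le> b"
  shows "emeasure (stieltjes l) {a..b} = ennreal (l b - l a)"
    and "emeasure (stieltjes l) {a<..b} = ennreal (l b - l a)"
proof -
  note l = clock_continuous_mono[OF assms(1,2)]
  show "emeasure (stieltjes l) {a..b} = ennreal (l b - l a)"
    unfolding stieltjes_def using assms l by (subst emeasure_interval_measure_Icc) auto
  have "continuous (at_right x) (\<lambda>t. l (max 0 t))" for x
    using l(1) by (simp add: continuous_on_eq_continuous_at continuous_at_imp_continuous_at_within)
  then show "emeasure (stieltjes l) {a<..b} = ennreal (l b - l a)"
    unfolding stieltjes_def using assms l by (subst emeasure_interval_measure_Ioc) auto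
qed

lemma sum_telescope_grid:
  fixes g :: "real \<Rightarrow> 'b::ab_group_add"
  assumes "0 < n"
  shows "(\<Sum>k<n. g (real (Suc k) / real n) - g (real k / real n)) = g 1 - g 0"
  using sum_lessThan_telescope[of "\<lambda>k. g (real k / real n)" n] assms by simp

lemma sum_grid_indicator:
  fixes h :: "nat \<Rightarrow> 'b::real_vector"
  assumes n: "0 < n" and s: "0 < s" "s \<le> 1"
  obtains k where "k < n" "real k / real n < s" "s \<le> real (Suc k) / real n"
    "(\<Sum>j<n. indicator {real j / real n<..real (Suc j) / real n} s *\<^sub>R h j) = h k"
proof -
  \<comment> \<open>The cells are closed on the right, so rounding up finds the cell of \<open>s\<close>.\<close>
  define k where "k = nat \<lceil>real n * s\<rceil> - 1"
  have pos: "0 < real n * s" using n s by simp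
  then have c: "0 < \<lceil>real n * s\<rceil>" by simp
  have k: "real k < real n * s" "real n * s \<le> real k + 1"
    using c unfolding k_def by linarith+
  have "real k < real n" using k(1) s n by (smt (verit) mult_left_le of_nat_0_le_iff)
  then have kn: "k < n" by simp
  have uniq: "j = k" if "real j < real n * s" "real n * s \<le> real j + 1" for j
    using k that by linarith
  have ind: "indicator {real j / real n<..real (Suc j) / real n} s = (if j = k then 1 else 0 :: real)" for j
    using uniq[of j] k n by (auto simp: indicator_def field_simps)
  show ?thesis
  proof (rule that[of k])
    show "(\<Sum>j<n. indicator {real j / real n<..real (Suc j) / real n} s *\<^sub>R h j) = h k"
      unfolding ind using kn by (simp add: if_distrib[of "\<lambda>c. c *\<^sub>R _"] cong: if_cong)
  qed (use kn k n in \<open>auto simp: field_simps\<close>)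
qed

text \<open>
  The sums are integrals of step functions that take on each cell the value of \<open>g\<close> at its right
  end point, so dominated convergence applies. The limiting step function vanishes at \<open>0\<close>, which is harmless because a
  continuous clock gives no mass to a point.
\<close>

lemma riemann_stieltjes:
  fixes g :: "real \<Rightarrow> 'b::{banach, second_countable_topology}"
  assumes l: "continuous_on {0..} l" "mono_on {0..} l" and g: "continuous_on {0..1} g"
  shows "(\<lambda>n. \<Sum>k<n. (l (real (Suc k) / real n) - l (real k / real n)) *\<^sub>R g (real (Suc k) / real n))
           \<longlonglongrightarrow> (LINT s:{0..1}|stieltjes l. g s)"
proof -
  let ?I = "\<lambda>n k. {real k / real n<..real (Suc k) / real n}"
  let ?f = "\<lambda>n s. \<Sum>k<n. indicator (?I n k) s *\<^sub>R g (real (Suc k) / real n)"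
  obtain B where B: "\<And>s. s \<in> {0..1} \<Longrightarrow> norm (g s) \<le> B"
    using compact_imp_bounded[OF compact_continuous_image[OF g compact_Icc]]
    unfolding bounded_iff by (metis imageI)
  have fin: "emeasure (stieltjes l) (?I n k) < \<infinity>" for n k
    by (subst emeasure_stieltjes[OF l]) (auto simp: divide_right_mono)
  have *: "(\<lambda>n. integral\<^sup>L (stieltjes l) (?f n)) \<longlonglongrightarrow> (LINT s:{0<..1}|stieltjes l. g s)"
    unfolding set_lebesgue_integral_def
  proof (rule integral_dominated_convergence[where w="\<lambda>s. B * indicator {0..1} s"])
    show "(\<lambda>s. indicat_real {0<..1} s *\<^sub>R g s) \<in> borel_measurable (stieltjes l)"
      using borel_measurable_continuous_on_indicator[of "{0<..1}" g] continuous_on_subset[OF g greaterThanAtMost_subseteq_atLeastAtMost_iff[THEN iffD2]]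
      by (simp add: measurable_cong_sets[OF sets_stieltjes refl])
    show "integrable (stieltjes l) (\<lambda>s. B * indicator {0..1} s)"
      by (intro integrable_mult_right integrable_real_indicator) (auto simp: emeasure_stieltjes[OF l])
    show "AE s in stieltjes l. (\<lambda>n. ?f n s) \<longlonglongrightarrow> indicator {0<..1} s *\<^sub>R g s"
    proof (intro AE_I2)
      fix s :: real
      show "(\<lambda>n. ?f n s) \<longlonglongrightarrow> indicator {0<..1} s *\<^sub>R g s"
      proof (cases "0 < s \<and> s \<le> 1")
        case True
        have "\<exists>c\<in>{0..1}. \<bar>c - s\<bar> \<le> 1 / real n \<and> ?f n s = g c" if n: "0 < n" for n
        proof -
          obtain k where "k < n" "real k / real n < s" "s \<le> real (Suc k) / real n" "?f n s = g (real (Suc k) / real n)"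
            using sum_grid_indicator[OF n, of s "\<lambda>k. g (real (Suc k) / real n)"] True by auto
          then show ?thesis using n
            by (intro bexI[of _ "real (Suc k) / real n"]) (auto simp: field_simps abs_if)
        qed
        then have "\<forall>n. \<exists>c. 0 < n \<longrightarrow> c \<in> {0..1} \<and> \<bar>c - s\<bar> \<le> 1 / real n \<and> ?f n s = g c"
          by blast
        from choice[OF this] obtain c where
          "\<forall>n. 0 < n \<longrightarrow> c n \<in> {0..1} \<and> \<bar>c n - s\<bar> \<le> 1 / real n \<and> ?f n s = g (c n)" ..
        then have c: "c n \<in> {0..1}" "\<bar>c n - s\<bar> \<le> 1 / real n" "?f n s = g (c n)" if "0 < n" for n
          using that by blast+
        have "(\<lambda>n. c n - s) \<longlonglongrightarrow> 0"
          by (rule Lim_null_comparison[OF _ lim_1_over_n])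
             (use c in \<open>auto intro!: eventually_sequentiallyI[of 1]\<close>)
        then have "c \<longlonglongrightarrow> s" by (simp add: LIM_zero_iff)
        then have "(\<lambda>n. g (c n)) \<longlonglongrightarrow> g s"
          using c True by (intro continuous_on_tendsto_compose[OF g]) (auto intro!: eventually_sequentiallyI[of 1])
        moreover have "\<forall>\<^sub>F n in sequentially. ?f n s = g (c n)"
          by (intro eventually_sequentiallyI[of 1] c) simp
        ultimately have "(\<lambda>n. ?f n s) \<longlonglongrightarrow> g s"
          by (subst tendsto_cong)
        then show ?thesis using True by simp
      next
        case False
        have "?f n s = 0" for n
        proof (intro sum.neutral ballI)
          fix k assume k: "k \<in> {..<n}"
          then have "real (Suc k) / real n \<le> 1" "0 \<le> real k / real n" by (auto simp: field_simps)
          then have "s \<notin> ?I n k" using False unfolding greaterThanAtMost_iff by linarith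
          then show "indicator (?I n k) s *\<^sub>R g (real (Suc k) / real n) = 0" by simp
        qed
        then show ?thesis using False by (auto simp: indicator_def)
      qed
    qed
    show "AE s in stieltjes l. norm (?f n s) \<le> B * indicator {0..1} s" for n
    proof (intro AE_I2)
      fix s :: real
      show "norm (?f n s) \<le> B * indicator {0..1} s"
      proof (cases "0 < n \<and> 0 < s \<and> s \<le> 1")
        case True
        then obtain k where "k < n" "?f n s = g (real (Suc k) / real n)"
          using sum_grid_indicator[of n s "\<lambda>k. g (real (Suc k) / real n)"] by auto
        then show ?thesis using True B[of "real (Suc k) / real n"] by (simp add: field_simps)
      next
        case False
        have "?f n s = 0"
        proof (intro sum.neutral ballI)
          fix k assume k: "k \<in> {..<n}"
          then have "real (Suc k) / real n \<le> 1" "0 \<le> real k / real n" by (auto simp: field_simps)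
          moreover have "0 < n" using k by auto
          ultimately have "s \<notin> ?I n k" using False unfolding greaterThanAtMost_iff by linarith
          then show "indicator (?I n k) s *\<^sub>R g (real (Suc k) / real n) = 0" by simp
        qed
        then show ?thesis using B[of 0] order_trans[OF norm_ge_zero, of "g 0" B] by simp
      qed
    qed
    show "?f n \<in> borel_measurable (stieltjes l)" for n
      by (intro borel_measurable_sum borel_measurable_scaleR borel_measurable_indicator) auto
  qed
  have "integral\<^sup>L (stieltjes l) (?f n) =
      (\<Sum>k<n. (l (real (Suc k) / real n) - l (real k / real n)) *\<^sub>R g (real (Suc k) / real n))" for n
  proof -
    have "integral\<^sup>L (stieltjes l) (?f n) = (\<Sum>k<n. measure (stieltjes l) (?I n k) *\<^sub>R g (real (Suc k) / real n))"
      using fin by (subst Bochner_Integration.integral_sum) (auto intro!: integrable_real_indicator integrable_scaleR_left)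
    moreover have "measure (stieltjes l) (?I n k) = l (real (Suc k) / real n) - l (real k / real n)" for k
    proof -
      have "l (real k / real n) \<le> l (real (Suc k) / real n)"
        by (intro mono_onD[OF l(2)]) (auto simp: divide_right_mono)
      then show ?thesis
        unfolding measure_def by (subst emeasure_stieltjes[OF l]) (auto simp: divide_right_mono)
    qed
    ultimately show ?thesis by simp
  qed
  moreover have "(LINT s:{0<..1}|stieltjes l. g s) = (LINT s:{0..1}|stieltjes l. g s)"
  proof -
    have "emeasure (stieltjes l) {0} = 0" using emeasure_stieltjes(1)[OF l, of 0 0] by simp
    then have "AE s in stieltjes l. s \<noteq> 0" by (intro AE_I[of _ _ "{0}"]) auto
    then have *: "AE s in stieltjes l. indicator {0<..1} s *\<^sub>R g s = indicator {0..1} s *\<^sub>R g s"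
      by eventually_elim (auto simp: indicator_def)
    have meas: "(\<lambda>s. indicator A s *\<^sub>R g s) \<in> borel_measurable (stieltjes l)"
      if "A \<in> sets borel" "A \<subseteq> {0..1}" for A :: "real set"
      using borel_measurable_continuous_on_indicator[OF that(1) continuous_on_subset[OF g that(2)]]
      by (simp add: measurable_cong_sets[OF sets_stieltjes refl])
    have "{0<..1::real} \<subseteq> {0..1}" by auto
    then show ?thesis
      unfolding set_lebesgue_integral_def by (intro integral_cong_AE meas *) simp_all
  qed
  ultimately show ?thesis using * by simp
qed

text \<open>
  By uniform continuity every increment is at most \<open>\<epsilon>\<close> on a fine grid, so the sum of squares is at
  most \<open>\<epsilon>\<close> times the total increment.
\<close>

lemma quadratic_variation_monotone:
  fixes m :: "real \<Rightarrow> real"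
  assumes m: "continuous_on {0..1} m" "mono_on {0..1} m"
  shows "(\<lambda>n. \<Sum>k<n. (m (real (Suc k) / real n) - m (real k / real n))\<^sup>2) \<longlonglongrightarrow> 0"
proof (rule LIMSEQ_I)
  fix e :: real assume e: "0 < e"
  let ?D = "\<lambda>n k. m (real (Suc k) / real n) - m (real k / real n)"
  \<comment> \<open>The summand 1 keeps the denominator positive when \<open>m\<close> is constant.\<close>
  define c where "c = m 1 - m 0 + 1"
  have c: "0 < c" unfolding c_def using mono_onD[OF m(2), of 0 1] by auto
  obtain d where d: "0 < d" "\<And>x y. x \<in> {0..1} \<Longrightarrow> y \<in> {0..1} \<Longrightarrow> dist y x < d \<Longrightarrow> dist (m y) (m x) < e / c"
    using compact_uniformly_continuous[OF m(1) compact_Icc] e c unfolding uniformly_continuous_on_def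
    by (metis divide_pos_pos)
  obtain N where N: "0 < N" "1 / real N < d" using d(1) by (metis nat_approx_posE of_nat_Suc zero_less_Suc)
  have "norm ((\<Sum>k<n. (?D n k)\<^sup>2) - 0) < e" if n: "N \<le> n" for n
  proof -
    have n0: "0 < n" using n N by simp
    have nd: "1 / real n < d" using N n by (smt (verit) frac_le of_nat_0_less_iff of_nat_mono)
    have D: "0 \<le> ?D n k" "?D n k \<le> e / c" if "k < n" for k
    proof -
      have in01: "real (Suc k) / real n \<in> {0..1}" "real k / real n \<in> {0..1}"
        using that by (auto simp: field_simps)
      have le: "real k / real n \<le> real (Suc k) / real n" by (simp add: divide_right_mono)
      show "0 \<le> ?D n k" using mono_onD[OF m(2) in01(2,1) le] by simp
      have "dist (real (Suc k) / real n) (real k / real n) = 1 / real n"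
        by (simp add: dist_real_def diff_divide_distrib[symmetric])
      then show "?D n k \<le> e / c" using d(2)[OF in01(2,1)] nd by (auto simp: dist_real_def)
    qed
    have "(\<Sum>k<n. (?D n k)\<^sup>2) \<le> (\<Sum>k<n. e / c * ?D n k)"
      unfolding power2_eq_square using D by (intro sum_mono mult_right_mono) auto
    also have "\<dots> = e / c * (m 1 - m 0)"
      unfolding sum_distrib_left[symmetric] using sum_telescope_grid[OF n0, of m] by simp
    also have "\<dots> < e" unfolding c_def using e c[unfolded c_def] by (simp add: field_simps)
    finally show ?thesis by (simp add: sum_nonneg)
  qed
  then show "\<exists>N. \<forall>n\<ge>N. norm ((\<Sum>k<n. (?D n k)\<^sup>2) - 0) < e" by blast
qed

lemma exp_imaginary_remainder:
  assumes "Re w = 0"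
  shows "norm (1 - exp (- w)) \<le> norm w" "norm (1 - exp (- w) - w) \<le> (norm w)\<^sup>2"
proof -
  have w: "- w = \<i> * of_real (- Im w)" "norm w = \<bar>Im w\<bar>"
    using assms by (auto simp: complex_eq_iff cmod_def)
  show "norm (1 - exp (- w)) \<le> norm w"
    using iexp_approx1[of "- Im w" 0] unfolding w by (simp add: norm_minus_commute)
  have "1 - exp (- w) - w = - (exp (- w) - (1 + - w))" by simp
  then have "norm (1 - exp (- w) - w) = norm (exp (- w) - (1 + - w))" by (simp only: norm_minus_cancel)
  also have "\<dots> \<le> \<bar>Im w\<bar>\<^sup>2 / 2"
    using iexp_approx1[of "- Im w" 1] unfolding w(1) by (simp add: fact_numeral power2_eq_square)
  also have "\<dots> \<le> (norm w)\<^sup>2" unfolding w(2) by simp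
  finally show "norm (1 - exp (- w) - w) \<le> (norm w)\<^sup>2" .
qed

text \<open>
  This is the only chain rule that the argument needs: over a fine grid \<open>1 - exp (- w)\<close> may be
  replaced by \<open>w\<close>, since the second-order errors add up to at most a multiple of the quadratic
  variation of the monotone function \<open>l1 + l2\<close>.
\<close>

lemma exponential_sums_tendsto_stieltjes:
  fixes g :: "real \<Rightarrow> complex" and l1 l2 :: "real \<Rightarrow> real"
  assumes l1: "continuous_on {0..} l1" "mono_on {0..} l1"
    and l2: "continuous_on {0..} l2" "mono_on {0..} l2"
    and g: "continuous_on {0..1} g" and a: "Re a = 0" and b: "Re b = 0"
  defines "dl1 \<equiv> \<lambda>n k. l1 (real (Suc k) / real n) - l1 (real k / real n)"
    and "dl2 \<equiv> \<lambda>n k. l2 (real (Suc k) / real n) - l2 (real k / real n)"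
  shows "(\<lambda>n. \<Sum>k<n. g (real (Suc k) / real n) * (1 - exp (- (a * dl1 n k + b * dl2 n k))))
    \<longlonglongrightarrow> a * (LINT s:{0..1}|stieltjes l1. g s) + b * (LINT s:{0..1}|stieltjes l2. g s)"
proof -
  let ?g = "\<lambda>n k. g (real (Suc k) / real n)" and ?w = "\<lambda>n k. a * dl1 n k + b * dl2 n k"
  obtain B where B: "\<And>s. s \<in> {0..1} \<Longrightarrow> norm (g s) \<le> B"
    using compact_imp_bounded[OF compact_continuous_image[OF g compact_Icc]]
    unfolding bounded_iff by (metis imageI)
  have B0: "0 \<le> B" using order_trans[OF norm_ge_zero B[of 0]] by simp
  define c where "c = norm a + norm b"
  have mono: "0 \<le> dl1 n k" "0 \<le> dl2 n k" for n k
    unfolding dl1_def dl2_def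
    by (auto intro!: mono_onD[OF l1(2)] mono_onD[OF l2(2)] simp: divide_right_mono)
  have "norm (?w n k) \<le> norm a * dl1 n k + norm b * dl2 n k" for n k
    by (rule order_trans[OF norm_triangle_ineq]) (use mono in \<open>simp add: norm_mult\<close>)
  also have "norm a * dl1 n k + norm b * dl2 n k \<le> c * (dl1 n k + dl2 n k)" for n k
    unfolding c_def using mono[of n k] by (simp add: distrib_left distrib_right add_increasing)
  finally have w: "norm (?w n k) \<le> c * (dl1 n k + dl2 n k)" for n k .
  have "continuous_on {0..1} (\<lambda>t. l1 t + l2 t)"
    using l1(1) l2(1) by (intro continuous_on_add) (auto intro: continuous_on_subset)
  then have "(\<lambda>n. \<Sum>k<n. (dl1 n k + dl2 n k)\<^sup>2) \<longlonglongrightarrow> 0"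
    using quadratic_variation_monotone[of "\<lambda>t. l1 t + l2 t"] l1 l2
    unfolding dl1_def dl2_def
    by (auto simp: algebra_simps mono_on_def add_mono)
  then have "(\<lambda>n. B * (c\<^sup>2 * (\<Sum>k<n. (dl1 n k + dl2 n k)\<^sup>2))) \<longlonglongrightarrow> 0"
    by (intro tendsto_mult_right_zero)
  then have "(\<lambda>n. \<Sum>k<n. ?g n k * (1 - exp (- ?w n k) - ?w n k)) \<longlonglongrightarrow> 0"
  proof (rule Lim_null_comparison[rotated], intro always_eventually allI)
    fix n
    have "norm (\<Sum>k<n. ?g n k * (1 - exp (- ?w n k) - ?w n k)) \<le> (\<Sum>k<n. B * (c\<^sup>2 * (dl1 n k + dl2 n k)\<^sup>2))"
    proof (intro sum_norm_le)
      fix k assume k: "k \<in> {..<n}"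
      have "norm (1 - exp (- ?w n k) - ?w n k) \<le> (norm (?w n k))\<^sup>2"
        using a b by (intro exp_imaginary_remainder) simp
      also have "\<dots> \<le> (c * (dl1 n k + dl2 n k))\<^sup>2" using w by (intro power_mono) auto
      finally show "norm (?g n k * (1 - exp (- ?w n k) - ?w n k)) \<le> B * (c\<^sup>2 * (dl1 n k + dl2 n k)\<^sup>2)"
        unfolding norm_mult power_mult_distrib[symmetric] using k B0
        by (intro mult_mono B) auto
    qed
    then show "norm (\<Sum>k<n. ?g n k * (1 - exp (- ?w n k) - ?w n k)) \<le> B * (c\<^sup>2 * (\<Sum>k<n. (dl1 n k + dl2 n k)\<^sup>2))"
      by (simp add: sum_distrib_left)
  qed
  moreover have "(\<lambda>n. a * (\<Sum>k<n. dl1 n k *\<^sub>R ?g n k) + b * (\<Sum>k<n. dl2 n k *\<^sub>R ?g n k))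
      \<longlonglongrightarrow> a * (LINT s:{0..1}|stieltjes l1. g s) + b * (LINT s:{0..1}|stieltjes l2. g s)"
    unfolding dl1_def dl2_def by (intro tendsto_intros riemann_stieltjes l1 l2 g)
  ultimately have "(\<lambda>n. (\<Sum>k<n. ?g n k * (1 - exp (- ?w n k) - ?w n k)) +
      (a * (\<Sum>k<n. dl1 n k *\<^sub>R ?g n k) + b * (\<Sum>k<n. dl2 n k *\<^sub>R ?g n k)))
      \<longlonglongrightarrow> 0 + (a * (LINT s:{0..1}|stieltjes l1. g s) + b * (LINT s:{0..1}|stieltjes l2. g s))"
    by (rule tendsto_add)
  moreover have "(\<Sum>k<n. ?g n k * (1 - exp (- ?w n k) - ?w n k)) +
      (a * (\<Sum>k<n. dl1 n k *\<^sub>R ?g n k) + b * (\<Sum>k<n. dl2 n k *\<^sub>R ?g n k))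
      = (\<Sum>k<n. ?g n k * (1 - exp (- ?w n k)))" for n
    unfolding sum_distrib_left sum.distrib[symmetric]
    by (intro sum.cong refl) (simp add: scaleR_conv_of_real algebra_simps)
  ultimately show ?thesis by simp
qed

section \<open>Analytic and probabilistic preliminaries\<close>

lemma tendsto_n_times_one_minus_exp:
  fixes K :: complex
  shows "(\<lambda>n. of_nat n * (1 - exp (K / of_nat n))) \<longlonglongrightarrow> - K"
proof -
  have "((\<lambda>h. exp (h * K)) has_field_derivative K) (at 0)"
    by (auto intro!: derivative_eq_intros)
  then have "(\<lambda>h. (exp (h * K) - 1) / h) \<midarrow>0\<rightarrow> K" by (simp add: DERIV_def)
  moreover have "filterlim (\<lambda>n. 1 / of_nat n :: complex) (at 0) sequentially"
    unfolding filterlim_at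
    by (auto intro!: lim_1_over_n eventually_sequentiallyI[of 1])
  ultimately have "(\<lambda>n. (exp (1 / of_nat n * K) - 1) / (1 / of_nat n)) \<longlonglongrightarrow> K"
    by (rule filterlim_compose)
  then have "(\<lambda>n. - ((exp (1 / of_nat n * K) - 1) / (1 / of_nat n))) \<longlonglongrightarrow> - K" by (rule tendsto_minus)
  then show ?thesis by (simp add: algebra_simps)
qed

text \<open>
  Boundedness makes real and imaginary part integrable, which reduces the claim to real functions.
\<close>

lemma integral_bind_bounded:
  fixes f :: "'b \<Rightarrow> complex"
  assumes fin: "finite_measure M" and K: "K \<in> measurable M (subprob_algebra N)"
    and f: "f \<in> borel_measurable N" and bd: "\<And>x. norm (f x) \<le> B"
  shows "(\<integral>x. f x \<partial>(M \<bind> K)) = (\<integral>x. (\<integral>y. f y \<partial>K x) \<partial>M)"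
proof -
  have *: "(\<integral>x. g x \<partial>(M \<bind> K)) = (\<integral>x. (\<integral>y. g y \<partial>K x) \<partial>M) \<and> integrable (M \<bind> K) g"
    if g[measurable]: "g \<in> borel_measurable N" and gb: "\<And>x. \<bar>g x\<bar> \<le> B" for g :: "'b \<Rightarrow> real"
  proof (cases "space M = {}")
    case True
    then show ?thesis using Bochner_Integration.integral_empty[OF True, of "\<lambda>x. \<integral>y. g y \<partial>K x"] Bochner_Integration.integral_empty[of "count_space {}" g]
      by (simp add: bind_empty real_integrable_def nn_integral_count_space)
  next
    case False
    let ?J = "distr M (subprob_algebra N) K"
    have J: "finite_measure ?J" by (rule finite_measure.finite_measure_distr[OF fin K])
    have 1: "AE M' in ?J. emeasure M' (space M') \<le> ennreal 1"
      using K by (intro AE_I2) (auto simp: space_subprob_algebra subprob_space.emeasure_space_le_1)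
    have "integrable (join ?J) g" "integral\<^sup>L (join ?J) g = (\<integral>M'. integral\<^sup>L M' g \<partial>?J)"
      using integrable_join[OF g gb _ J 1] integral_join[OF g gb _ J 1] by simp_all
    moreover have "(\<integral>M'. integral\<^sup>L M' g \<partial>?J) = (\<integral>x. (\<integral>y. g y \<partial>K x) \<partial>M)"
      by (intro integral_distr[OF K]) measurable
    ultimately show ?thesis by (simp add: bind_nonempty''[OF K False])
  qed
  have [measurable]: "f \<in> borel_measurable N" by fact
  have R: "(\<integral>x. Re (f x) \<partial>(M \<bind> K)) = (\<integral>x. (\<integral>y. Re (f y) \<partial>K x) \<partial>M)" "integrable (M \<bind> K) (\<lambda>x. Re (f x))"
    using *[of "\<lambda>x. Re (f x)"] order_trans[OF abs_Re_le_cmod bd] by auto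
  have I: "(\<integral>x. Im (f x) \<partial>(M \<bind> K)) = (\<integral>x. (\<integral>y. Im (f y) \<partial>K x) \<partial>M)" "integrable (M \<bind> K) (\<lambda>x. Im (f x))"
    using *[of "\<lambda>x. Im (f x)"] order_trans[OF abs_Im_le_cmod bd] by auto
  have int: "integrable (M \<bind> K) f"
  proof -
    have "integrable (M \<bind> K) (\<lambda>x. complex_of_real (Re (f x)) + \<i> * complex_of_real (Im (f x)))"
      using R(2) I(2) by (intro Bochner_Integration.integrable_add integrable_mult_right integrable_of_real)
    then show ?thesis by (simp only: complex_eq[symmetric])
  qed
  have kint: "integrable (K x) f" if "x \<in> space M" for x
  proof -
    interpret K: subprob_space "K x" using subprob_space_kernel[OF K that] .
    have "f \<in> borel_measurable (K x)" using f sets_kernel[OF K that] by (simp cong: measurable_cong_sets)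
    then show ?thesis by (intro K.integrable_const_bound[where B=B]) (simp_all add: bd)
  qed
  have Kint: "integrable M (\<lambda>x. \<integral>y. f y \<partial>K x)"
  proof (rule finite_measure.integrable_const_bound[OF fin, where B=B], rule AE_I2)
    show "(\<lambda>x. \<integral>y. f y \<partial>K x) \<in> borel_measurable M"
      by (rule measurable_compose[OF K integral_measurable_subprob_algebra[OF f]])
    fix x assume x: "x \<in> space M"
    interpret K: subprob_space "K x" using subprob_space_kernel[OF K x] .
    have "norm (\<integral>y. f y \<partial>K x) \<le> (\<integral>y. norm (f y) \<partial>K x)" by (rule integral_norm_bound)
    also have "\<dots> \<le> (\<integral>y. B \<partial>K x)" using kint[OF x] bd by (intro integral_mono) auto
    also have "\<dots> = measure (K x) (space (K x)) * B" by simp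
    also have "\<dots> \<le> 1 * B" using order_trans[OF norm_ge_zero bd] K.subprob_measure_le_1 by (intro mult_right_mono) auto
    finally show "norm (\<integral>y. f y \<partial>K x) \<le> B" by simp
  qed
  have eqs: "Re (\<integral>y. f y \<partial>K x) = (\<integral>y. Re (f y) \<partial>K x)" "Im (\<integral>y. f y \<partial>K x) = (\<integral>y. Im (f y) \<partial>K x)"
    if "x \<in> space M" for x using kint[OF that] by simp_all
  show "(\<integral>x. f x \<partial>(M \<bind> K)) = (\<integral>x. (\<integral>y. f y \<partial>K x) \<partial>M)"
  proof (rule complex_eqI)
    have "Re (\<integral>x. f x \<partial>(M \<bind> K)) = (\<integral>x. (\<integral>y. Re (f y) \<partial>K x) \<partial>M)" using int R by simp
    also have "\<dots> = (\<integral>x. Re (\<integral>y. f y \<partial>K x) \<partial>M)" by (intro Bochner_Integration.integral_cong) (simp_all add: eqs)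
    also have "\<dots> = Re (\<integral>x. (\<integral>y. f y \<partial>K x) \<partial>M)" using Kint by simp
    finally show "Re (\<integral>x. f x \<partial>(M \<bind> K)) = Re (\<integral>x. (\<integral>y. f y \<partial>K x) \<partial>M)" .
    have "Im (\<integral>x. f x \<partial>(M \<bind> K)) = (\<integral>x. (\<integral>y. Im (f y) \<partial>K x) \<partial>M)" using int I by simp
    also have "\<dots> = (\<integral>x. Im (\<integral>y. f y \<partial>K x) \<partial>M)" by (intro Bochner_Integration.integral_cong) (simp_all add: eqs)
    also have "\<dots> = Im (\<integral>x. (\<integral>y. f y \<partial>K x) \<partial>M)" using Kint by simp
    finally show "Im (\<integral>x. f x \<partial>(M \<bind> K)) = Im (\<integral>x. (\<integral>y. f y \<partial>K x) \<partial>M)" .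
  qed
qed

text \<open>
  The variables \<open>X\<close> and \<open>Y\<close> may have no mean, so their means cannot be subtracted. Truncating
  both at level \<open>n\<close> gives differences of mean zero that are still bounded below by \<open>- \<bar>g\<bar>\<close>, because truncation is monotone and
  1-Lipschitz. Fatou's lemma then bounds the mean of \<open>X - Y + \<bar>g\<bar>\<close> by that of \<open>\<bar>g\<bar>\<close>.
\<close>

lemma (in prob_space) integrable_increment_of_equal_laws:
  fixes X Y g :: "'a \<Rightarrow> real"
  assumes [measurable]: "X \<in> borel_measurable M" "Y \<in> borel_measurable M"
    and law: "distr M borel X = distr M borel Y"
    and g: "integrable M g" and ge: "AE \<omega> in M. g \<omega> \<le> X \<omega> - Y \<omega>"
  shows "integrable M (\<lambda>\<omega>. X \<omega> - Y \<omega>)"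
proof -
  define c where "c n x = max (- real n) (min (real n) x)" for n and x :: real
  have c_meas[measurable]: "c n \<in> borel_measurable borel" for n unfolding c_def by measurable
  have [measurable]: "g \<in> borel_measurable M" using g by simp
  have c_int: "integrable M (\<lambda>\<omega>. c n (V \<omega>))" if [measurable]: "V \<in> borel_measurable M" for n V
    by (rule integrable_const_bound[where B="real n"]) (auto simp: c_def)
  have ge': "AE \<omega> in M. \<forall>n. 0 \<le> c n (X \<omega>) - c n (Y \<omega>) + \<bar>g \<omega>\<bar>"
    using ge by eventually_elim (auto simp: c_def max_def min_def)
  have mean: "(\<integral>\<^sup>+\<omega>. ennreal (c n (X \<omega>) - c n (Y \<omega>) + \<bar>g \<omega>\<bar>) \<partial>M) = ennreal (\<integral>\<omega>. \<bar>g \<omega>\<bar> \<partial>M)" for n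
  proof -
    have "(\<integral>\<omega>. c n (X \<omega>) \<partial>M) = (\<integral>x. c n x \<partial>distr M borel X)" by (simp add: integral_distr)
    also have "\<dots> = (\<integral>\<omega>. c n (Y \<omega>) \<partial>M)" unfolding law by (simp add: integral_distr)
    finally have "(\<integral>\<omega>. c n (X \<omega>) - c n (Y \<omega>) + \<bar>g \<omega>\<bar> \<partial>M) = (\<integral>\<omega>. \<bar>g \<omega>\<bar> \<partial>M)"
      using c_int g by simp
    moreover have "AE \<omega> in M. 0 \<le> c n (X \<omega>) - c n (Y \<omega>) + \<bar>g \<omega>\<bar>" using ge' by eventually_elim simp
    ultimately show ?thesis
      using c_int g by (subst nn_integral_eq_integral) auto
  qed
  have lim: "(\<lambda>n. ennreal (c n (X \<omega>) - c n (Y \<omega>) + \<bar>g \<omega>\<bar>)) \<longlonglongrightarrow> ennreal (X \<omega> - Y \<omega> + \<bar>g \<omega>\<bar>)" for \<omega>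
  proof -
    obtain N where N: "max \<bar>X \<omega>\<bar> \<bar>Y \<omega>\<bar> \<le> real N" using real_arch_simple by blast
    have "c n (X \<omega>) = X \<omega>" "c n (Y \<omega>) = Y \<omega>" if "N \<le> n" for n
      using N that of_nat_mono[OF that, where 'a=real] unfolding c_def by linarith+
    then show ?thesis by (intro tendsto_eventually eventually_sequentiallyI[of N]) simp
  qed
  have "(\<integral>\<^sup>+\<omega>. ennreal (X \<omega> - Y \<omega> + \<bar>g \<omega>\<bar>) \<partial>M)
      = (\<integral>\<^sup>+\<omega>. liminf (\<lambda>n. ennreal (c n (X \<omega>) - c n (Y \<omega>) + \<bar>g \<omega>\<bar>)) \<partial>M)"
    by (intro nn_integral_cong lim_imp_Liminf[symmetric] lim) simp
  also have "\<dots> \<le> liminf (\<lambda>n. \<integral>\<^sup>+\<omega>. ennreal (c n (X \<omega>) - c n (Y \<omega>) + \<bar>g \<omega>\<bar>) \<partial>M)"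
    by (rule nn_integral_liminf) measurable
  also have "\<dots> = ennreal (\<integral>\<omega>. \<bar>g \<omega>\<bar> \<partial>M)" by (simp add: mean Liminf_const)
  finally have "(\<integral>\<^sup>+\<omega>. ennreal (X \<omega> - Y \<omega> + \<bar>g \<omega>\<bar>) \<partial>M) < \<infinity>" by (rule le_less_trans) simp
  moreover have "AE \<omega> in M. 0 \<le> X \<omega> - Y \<omega> + \<bar>g \<omega>\<bar>" using ge by eventually_elim auto
  ultimately have "integrable M (\<lambda>\<omega>. X \<omega> - Y \<omega> + \<bar>g \<omega>\<bar>)"
    by (intro integrableI_nonneg) auto
  from Bochner_Integration.integrable_diff[OF this integrable_abs[OF g]] show ?thesis by simp
qed

lemma (in prob_space) expectation_iexp_normal:
  assumes X: "distributed M lborel X (normal_density 0 \<sigma>)" and \<sigma>: "0 < \<sigma>"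
  shows "(\<integral>\<omega>. exp (\<i> * complex_of_real (X \<omega>)) \<partial>M) = complex_of_real (exp (- \<sigma>\<^sup>2 / 2))"
proof -
  have D: "distributed M lborel (\<lambda>\<omega>. X \<omega> / \<sigma>) std_normal_density"
    using X normal_standard_normal_convert[OF \<sigma>, of X 0] by simp
  then have meas: "(\<lambda>\<omega>. X \<omega> / \<sigma>) \<in> borel_measurable M" by (simp add: distributed_def measurable_lborel1)
  have "std_normal_distribution = distr M lborel (\<lambda>\<omega>. X \<omega> / \<sigma>)"
    using D by (simp add: distributed_def)
  then have "char std_normal_distribution \<sigma> = (\<integral>x. iexp (\<sigma> * x) \<partial>distr M lborel (\<lambda>\<omega>. X \<omega> / \<sigma>))"
    by (simp add: char_def)
  also have "\<dots> = (\<integral>\<omega>. iexp (\<sigma> * (X \<omega> / \<sigma>)) \<partial>M)"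
    using meas by (intro integral_distr) (simp_all add: measurable_lborel2 measurable_lborel1)
  finally show ?thesis using \<sigma> by (simp add: char_std_normal_distribution)
qed

text \<open>
  Written as an integral over the line, the moment is visibly the same under every law that gives
  \<open>X\<close> this density; this is used for all starting points of the process at once.
\<close>

lemma (in prob_space) normal_absolute_moment:
  assumes X: "distributed M lborel X (normal_density 0 \<sigma>)" and \<sigma>: "0 < \<sigma>"
  shows "(\<integral>\<^sup>+\<omega>. ennreal \<bar>X \<omega>\<bar> \<partial>M) = (\<integral>\<^sup>+x. ennreal (normal_density 0 \<sigma> x) * ennreal \<bar>x\<bar> \<partial>lborel)"
    and "(\<integral>\<^sup>+x. ennreal (normal_density 0 \<sigma> x) * ennreal \<bar>x\<bar> \<partial>lborel) < \<infinity>"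
proof -
  show "(\<integral>\<^sup>+\<omega>. ennreal \<bar>X \<omega>\<bar> \<partial>M) = (\<integral>\<^sup>+x. ennreal (normal_density 0 \<sigma> x) * ennreal \<bar>x\<bar> \<partial>lborel)"
    by (rule distributed_nn_integral[OF X, symmetric]) simp
  have "integrable lborel (\<lambda>x. normal_density 0 \<sigma> x * (x - 0) ^ 1)"
    using \<sigma> by (rule integrable_normal_moment)
  then have "(\<integral>\<^sup>+x. ennreal (norm (normal_density 0 \<sigma> x * x)) \<partial>lborel) < \<infinity>"
    by (simp add: integrable_iff_bounded)
  then show "(\<integral>\<^sup>+x. ennreal (normal_density 0 \<sigma> x) * ennreal \<bar>x\<bar> \<partial>lborel) < \<infinity>"
    by (simp add: abs_mult ennreal_mult)
qed

lemma (in prob_space) expectation_mult_indep_sigma: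
  fixes U :: "'a \<Rightarrow> complex" and v :: "'b::topological_space \<Rightarrow> complex"
  assumes sub: "subalgebra M F" and indep: "indep_set (sets F) (sets (vimage_algebra (space M) Y borel))"
    and U: "U \<in> borel_measurable F" "integrable M U"
    and Y: "Y \<in> borel_measurable M" and v: "v \<in> borel_measurable borel" "integrable M (\<lambda>\<omega>. v (Y \<omega>))"
  shows "(\<integral>\<omega>. U \<omega> * v (Y \<omega>) \<partial>M) = (\<integral>\<omega>. U \<omega> \<partial>M) * (\<integral>\<omega>. v (Y \<omega>) \<partial>M)"
proof (rule indep_var_lebesgue_integral[OF _ U(2) v(2)])
  have "sigma_sets (space M) {U -` A \<inter> space M |A. A \<in> sets borel} \<subseteq> sets F"
  proof -
    have sp: "space M = space F" using sub by (simp add: subalgebra_def)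
    have "{U -` A \<inter> space F |A. A \<in> sets borel} \<subseteq> sets F" using measurable_sets[OF U(1)] by blast
    then show ?thesis unfolding sp by (rule sets.sigma_sets_subset)
  qed
  moreover have "sigma_sets (space M) {(\<lambda>\<omega>. v (Y \<omega>)) -` A \<inter> space M |A. A \<in> sets borel} \<subseteq> sets (vimage_algebra (space M) Y borel)"
  proof -
    have *: "(\<lambda>\<omega>. v (Y \<omega>)) \<in> borel_measurable (vimage_algebra (space M) Y borel)"
      by (rule measurable_compose[OF measurable_vimage_algebra1 v(1)]) simp
    have "{(\<lambda>\<omega>. v (Y \<omega>)) -` A \<inter> space M |A. A \<in> sets borel} \<subseteq> sets (vimage_algebra (space M) Y borel)"
      using measurable_sets[OF *] unfolding space_vimage_algebra by blast
    from sets.sigma_sets_subset[OF this] show ?thesis by simp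
  qed
  ultimately have "indep_set (sigma_sets (space M) {U -` A \<inter> space M |A. A \<in> sets borel})
      (sigma_sets (space M) {(\<lambda>\<omega>. v (Y \<omega>)) -` A \<inter> space M |A. A \<in> sets borel})"
    using indep unfolding indep_sets2_eq by (meson subset_trans subsetD)
  moreover have "U \<in> borel_measurable M" using measurable_from_subalg[OF sub U(1)] .
  ultimately show "indep_var borel U borel (\<lambda>\<omega>. v (Y \<omega>))"
    unfolding indep_var_eq using measurable_compose[OF Y v(1)] by simp
qed

section \<open>Occupation measures\<close>

lemma borel_measurable_stieltjes_Icc:
  fixes g :: "real \<Rightarrow> 'b::real_normed_vector"
  assumes "continuous_on {0..} g"
  shows "g \<in> borel_measurable (restrict_space (stieltjes l) {0..1})"
proof -
  have "g \<in> borel_measurable (restrict_space borel {0..1})"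
    by (rule borel_measurable_continuous_on_restrict) (auto intro: continuous_on_subset[OF assms])
  then show ?thesis
    by (subst measurable_cong_sets[OF _ refl, of _ "restrict_space borel {0..1}"])
       (simp_all add: sets_restrict_space)
qed

text \<open>
  A continuous path \<open>Z\<close> observed through a continuous random clock \<open>L\<close>. The local times of both
  boundary half-lines are such clocks.
\<close>

locale occupation =
  fixes Q :: "'a measure" and Z :: "real \<Rightarrow> 'a \<Rightarrow> real \<times> real" and L :: "real \<Rightarrow> 'a \<Rightarrow> real"
  assumes prob_Q: "prob_space Q"
    and Z_measurable: "\<And>t. 0 \<le> t \<Longrightarrow> Z t \<in> borel_measurable Q"
    and Z_continuous: "\<And>\<omega>. \<omega> \<in> space Q \<Longrightarrow> continuous_on {0..} (\<lambda>t. Z t \<omega>)"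
    and L_measurable: "\<And>t. 0 \<le> t \<Longrightarrow> L t \<in> borel_measurable Q"
    and L_continuous: "\<And>\<omega>. \<omega> \<in> space Q \<Longrightarrow> continuous_on {0..} (\<lambda>t. L t \<omega>)"
    and L_mono: "\<And>\<omega>. \<omega> \<in> space Q \<Longrightarrow> mono_on {0..} (\<lambda>t. L t \<omega>)"
    and L_0: "\<And>\<omega>. \<omega> \<in> space Q \<Longrightarrow> L 0 \<omega> = 0"
begin

sublocale prob_space Q by (rule prob_Q)

lemma L_nonneg: "\<omega> \<in> space Q \<Longrightarrow> 0 \<le> t \<Longrightarrow> 0 \<le> L t \<omega>"
  using mono_onD[OF L_mono, of \<omega> 0 t] L_0 by simp

definition path_occupation :: "'a \<Rightarrow> (real \<times> real) measure" where
  "path_occupation \<omega> = distr (restrict_space (stieltjes (\<lambda>t. L t \<omega>)) {0..1}) borel (\<lambda>s. Z s \<omega>)"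

lemma sets_path_occupation [simp, measurable_cong]: "sets (path_occupation \<omega>) = sets borel"
  and space_path_occupation [simp]: "space (path_occupation \<omega>) = UNIV"
  by (simp_all add: path_occupation_def)

lemma Z_measurable_restrict:
  "\<omega> \<in> space Q \<Longrightarrow> (\<lambda>s. Z s \<omega>) \<in> borel_measurable (restrict_space (stieltjes l) {0..1})"
  by (intro borel_measurable_stieltjes_Icc Z_continuous)

lemma nn_integral_path_occupation:
  assumes "\<omega> \<in> space Q" "h \<in> borel_measurable borel"
  shows "(\<integral>\<^sup>+z. h z \<partial>path_occupation \<omega>) = (\<integral>\<^sup>+s\<in>{0..1}. h (Z s \<omega>) \<partial>stieltjes (\<lambda>t. L t \<omega>))"
  unfolding path_occupation_def using assms Z_measurable_restrict
  by (simp add: nn_integral_distr nn_integral_restrict_space)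

lemma integral_path_occupation:
  fixes h :: "_ \<Rightarrow> 'b::{banach, second_countable_topology}"
  assumes "\<omega> \<in> space Q" "h \<in> borel_measurable borel"
  shows "(\<integral>z. h z \<partial>path_occupation \<omega>) = (LINT s:{0..1}|stieltjes (\<lambda>t. L t \<omega>). h (Z s \<omega>))"
  unfolding path_occupation_def using assms Z_measurable_restrict
  by (simp add: integral_distr integral_restrict_space set_lebesgue_integral_def)

lemma emeasure_path_occupation_UNIV:
  assumes "\<omega> \<in> space Q"
  shows "emeasure (path_occupation \<omega>) UNIV = ennreal (L 1 \<omega>)"
  using nn_integral_path_occupation[OF assms, of "\<lambda>_. 1"]
    emeasure_stieltjes(1)[OF L_continuous[OF assms] L_mono[OF assms], of 0 1] L_0[OF assms]
  by (simp add: nn_integral_indicator[of "{0..1}"])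

lemma finite_path_occupation: "\<omega> \<in> space Q \<Longrightarrow> finite_measure (path_occupation \<omega>)"
  by (intro finite_measureI) (simp add: emeasure_path_occupation_UNIV)

text \<open>
  Measurability in \<open>\<omega>\<close> comes from Riemann sums, which involve the path at countably many times only.
\<close>

lemma integral_path_occupation_continuous_measurable:
  fixes h :: "_ \<Rightarrow> 'b::{banach, second_countable_topology}"
  assumes h: "continuous_on UNIV h"
  shows "(\<lambda>\<omega>. \<integral>z. h z \<partial>path_occupation \<omega>) \<in> borel_measurable Q"
proof (rule borel_measurable_LIMSEQ_metric)
  have [measurable]: "h \<in> borel_measurable borel" using h by (rule borel_measurable_continuous_onI)
  have [measurable]: "Z (real (Suc k) / real n) \<in> borel_measurable Q" "L (real k / real n) \<in> borel_measurable Q"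
    for k n by (auto intro!: Z_measurable L_measurable)
  show "(\<lambda>\<omega>. \<Sum>k<n. (L (real (Suc k) / real n) \<omega> - L (real k / real n) \<omega>) *\<^sub>R h (Z (real (Suc k) / real n) \<omega>))
    \<in> borel_measurable Q" for n by measurable
  fix \<omega> assume \<omega>: "\<omega> \<in> space Q"
  have "continuous_on {0..1} (\<lambda>s. h (Z s \<omega>))"
    by (rule continuous_on_compose2[OF h continuous_on_subset[OF Z_continuous[OF \<omega>]]]) auto
  from riemann_stieltjes[OF L_continuous[OF \<omega>] L_mono[OF \<omega>] this]
  show "(\<lambda>n. \<Sum>k<n. (L (real (Suc k) / real n) \<omega> - L (real k / real n) \<omega>) *\<^sub>R h (Z (real (Suc k) / real n) \<omega>))
     \<longlonglongrightarrow> (\<integral>z. h z \<partial>path_occupation \<omega>)"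
    using \<omega> by (simp add: integral_path_occupation)
qed

lemma emeasure_path_occupation_closed_measurable:
  assumes A: "closed A"
  shows "(\<lambda>\<omega>. emeasure (path_occupation \<omega>) A) \<in> borel_measurable Q"
proof (cases "A = {}")
  case False
  \<comment> \<open>Continuous functions that decrease to the indicator of \<open>A\<close>.\<close>
  define h where "h k z = max 0 (1 - real k * infdist z A)" for k and z :: "real \<times> real"
  have "(\<lambda>\<omega>. measure (path_occupation \<omega>) A) \<in> borel_measurable Q"
  proof (rule borel_measurable_LIMSEQ_metric)
    show "(\<lambda>\<omega>. \<integral>z. h k z \<partial>path_occupation \<omega>) \<in> borel_measurable Q" for k
      unfolding h_def by (intro integral_path_occupation_continuous_measurable continuous_intros)
    fix \<omega> assume \<omega>: "\<omega> \<in> space Q"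
    interpret O: finite_measure "path_occupation \<omega>" by (rule finite_path_occupation[OF \<omega>])
    have "(\<lambda>k. \<integral>z. h k z \<partial>path_occupation \<omega>) \<longlonglongrightarrow> (\<integral>z. indicator A z \<partial>path_occupation \<omega>)"
    proof (rule integral_dominated_convergence[where w="\<lambda>_. 1"])
      show "AE z in path_occupation \<omega>. (\<lambda>k. h k z) \<longlonglongrightarrow> indicator A z"
      proof (intro AE_I2)
        fix z
        show "(\<lambda>k. h k z) \<longlonglongrightarrow> indicator A z"
        proof (cases "z \<in> A")
          case True
          then show ?thesis by (simp add: h_def)
        next
          case nin: False
          then have pos: "0 < infdist z A"
            using A False by (metis in_closed_iff_infdist_zero infdist_nonneg less_eq_real_def)
          obtain N where N: "1 / infdist z A \<le> real N" using real_arch_simple by blast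
          have "h k z = 0" if "N \<le> k" for k
          proof -
            have "1 / infdist z A \<le> real k" using N that by linarith
            then show ?thesis using pos by (simp add: h_def field_simps)
          qed
          then have "\<forall>\<^sub>F k in sequentially. h k z = 0" by (intro eventually_sequentiallyI[of N])
          then show ?thesis using nin by (simp add: tendsto_eventually)
        qed
      qed
      show "h k \<in> borel_measurable (path_occupation \<omega>)" for k
        unfolding h_def by (simp add: measurable_cong_sets[OF sets_path_occupation refl])
           (intro borel_measurable_continuous_onI continuous_intros)
      show "indicat_real A \<in> borel_measurable (path_occupation \<omega>)"
        using A by (intro borel_measurable_indicator) (simp add: borel_closed)
    qed (auto simp: h_def infdist_nonneg)
    then show "(\<lambda>k. \<integral>z. h k z \<partial>path_occupation \<omega>) \<longlonglongrightarrow> measure (path_occupation \<omega>) A" by simp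
  qed
  then have "(\<lambda>\<omega>. ennreal (measure (path_occupation \<omega>) A)) \<in> borel_measurable Q" by simp
  then show ?thesis
    by (rule measurable_cong[THEN iffD1, rotated])
       (simp add: finite_measure.emeasure_eq_measure[OF finite_path_occupation])
qed simp

text \<open>
  The mass \<open>L 1 \<omega>\<close> of \<open>path_occupation \<omega>\<close> is unbounded in \<open>\<omega>\<close>, whereas kernels in the
  Giry monad are subprobabilities. Dividing by \<open>1 + L 1 \<omega>\<close> brings the mass below 1;
  \<open>occupation_measure\<close> below compensates by giving \<open>Q\<close> the density \<open>1 + L 1\<close>.
\<close>

definition normalised_occupation :: "'a \<Rightarrow> (real \<times> real) measure" where
  "normalised_occupation \<omega> = density (path_occupation \<omega>) (\<lambda>_. ennreal (1 / (1 + L 1 \<omega>)))"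

lemma emeasure_normalised_occupation:
  "A \<in> sets borel \<Longrightarrow> emeasure (normalised_occupation \<omega>) A = ennreal (1 / (1 + L 1 \<omega>)) * emeasure (path_occupation \<omega>) A"
  unfolding normalised_occupation_def by (simp add: emeasure_density nn_integral_cmult_indicator)

lemma normalised_occupation_kernel: "normalised_occupation \<in> measurable Q (subprob_algebra borel)"
proof (rule measurable_subprob_algebra_generated)
  show "sets (borel :: (real \<times> real) measure) = sigma_sets UNIV (Collect closed)"
    by (simp add: borel_eq_closed)
  show "Int_stable (Collect closed :: (real \<times> real) set set)" by (auto simp: Int_stable_def)
  show "subprob_space (normalised_occupation \<omega>)" if "\<omega> \<in> space Q" for \<omega>
  proof
    have "1 / (1 + L 1 \<omega>) * L 1 \<omega> \<le> 1" using L_nonneg[OF that, of 1] by (simp add: field_simps)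
    then have "ennreal (1 / (1 + L 1 \<omega>)) * ennreal (L 1 \<omega>) \<le> 1"
      using L_nonneg[OF that, of 1] by (subst ennreal_mult[symmetric]) auto
    then show "emeasure (normalised_occupation \<omega>) (space (normalised_occupation \<omega>)) \<le> 1"
      using emeasure_normalised_occupation[of UNIV \<omega>] that
      by (simp add: normalised_occupation_def emeasure_path_occupation_UNIV)
  qed (simp add: normalised_occupation_def)
  have [measurable]: "L 1 \<in> borel_measurable Q" by (simp add: L_measurable)
  have *: "(\<lambda>\<omega>. emeasure (normalised_occupation \<omega>) A) \<in> borel_measurable Q" if "closed A" for A
    using emeasure_path_occupation_closed_measurable[OF that] that
    by (simp add: emeasure_normalised_occupation borel_closed)
  show "(\<lambda>\<omega>. emeasure (normalised_occupation \<omega>) A) \<in> borel_measurable Q" if "A \<in> Collect closed" for A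
    using that * by simp
  show "(\<lambda>\<omega>. emeasure (normalised_occupation \<omega>) UNIV) \<in> borel_measurable Q"
    by (rule *) simp
qed (auto simp: normalised_occupation_def)

lemma emeasure_path_occupation_eq:
  assumes "\<omega> \<in> space Q" "A \<in> sets borel"
  shows "emeasure (path_occupation \<omega>) A = ennreal (1 + L 1 \<omega>) * emeasure (normalised_occupation \<omega>) A"
proof -
  have "ennreal (1 + L 1 \<omega>) * ennreal (1 / (1 + L 1 \<omega>)) = 1"
    using L_nonneg[OF assms(1), of 1] by (subst ennreal_mult[symmetric]) auto
  then show ?thesis
    using assms(2) by (simp only: emeasure_normalised_occupation mult.assoc[symmetric] mult_1)
qed

lemma emeasure_path_occupation_measurable:
  assumes "A \<in> sets borel"
  shows "(\<lambda>\<omega>. emeasure (path_occupation \<omega>) A) \<in> borel_measurable Q"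
proof -
  have [measurable]: "L 1 \<in> borel_measurable Q" by (simp add: L_measurable)
  have "(\<lambda>\<omega>. emeasure (normalised_occupation \<omega>) A) \<in> borel_measurable Q"
    by (rule measurable_emeasure_kernel[OF normalised_occupation_kernel assms])
  then have "(\<lambda>\<omega>. ennreal (1 + L 1 \<omega>) * emeasure (normalised_occupation \<omega>) A) \<in> borel_measurable Q" by simp
  then show ?thesis
    by (rule measurable_cong[THEN iffD1, rotated]) (simp add: emeasure_path_occupation_eq assms)
qed

definition occupation_measure :: "(real \<times> real) measure" where
  "occupation_measure = density Q (\<lambda>\<omega>. ennreal (1 + L 1 \<omega>)) \<bind> normalised_occupation"

lemma normalised_occupation_kernel':
  "normalised_occupation \<in> measurable (density Q f) (subprob_algebra borel)"
  using normalised_occupation_kernel by (simp cong: measurable_cong_sets)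

lemma sets_occupation_measure [simp, measurable_cong]: "sets occupation_measure = sets borel"
  and space_occupation_measure [simp]: "space occupation_measure = UNIV"
proof -
  show "sets occupation_measure = sets borel"
    unfolding occupation_measure_def
    by (rule sets_bind[OF sets_kernel[OF normalised_occupation_kernel']]) (simp_all add: not_empty)
  from sets_eq_imp_space_eq[OF this] show "space occupation_measure = UNIV" by simp
qed

text \<open>
  The factor \<open>1 + L 1\<close> cancels, so this is the expected time on the clock \<open>L\<close> that the path spends
  in \<open>A\<close> up to time 1.
\<close>

lemma emeasure_occupation_measure:
  assumes A: "A \<in> sets borel"
  shows "emeasure occupation_measure A = (\<integral>\<^sup>+\<omega>. emeasure (path_occupation \<omega>) A \<partial>Q)"
proof -
  have [measurable]: "L 1 \<in> borel_measurable Q" by (simp add: L_measurable)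
  have [measurable]: "(\<lambda>\<omega>. emeasure (normalised_occupation \<omega>) A) \<in> borel_measurable Q"
    by (rule measurable_emeasure_kernel[OF normalised_occupation_kernel A])
  have "emeasure occupation_measure A = (\<integral>\<^sup>+\<omega>. emeasure (normalised_occupation \<omega>) A \<partial>density Q (\<lambda>\<omega>. ennreal (1 + L 1 \<omega>)))"
    unfolding occupation_measure_def
    by (rule emeasure_bind[OF _ normalised_occupation_kernel' A]) (simp add: not_empty)
  also have "\<dots> = (\<integral>\<^sup>+\<omega>. ennreal (1 + L 1 \<omega>) * emeasure (normalised_occupation \<omega>) A \<partial>Q)"
    by (subst nn_integral_density) auto
  also have "\<dots> = (\<integral>\<^sup>+\<omega>. emeasure (path_occupation \<omega>) A \<partial>Q)"
    by (intro nn_integral_cong) (simp add: emeasure_path_occupation_eq A)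
  finally show ?thesis .
qed

lemma integral_occupation_measure:
  fixes h :: "real \<times> real \<Rightarrow> complex"
  assumes L: "integrable Q (L 1)" and h[measurable]: "h \<in> borel_measurable borel" and bd: "\<And>z. norm (h z) \<le> B"
  shows "(\<integral>z. h z \<partial>occupation_measure) = (\<integral>\<omega>. (LINT s:{0..1}|stieltjes (\<lambda>t. L t \<omega>). h (Z s \<omega>)) \<partial>Q)"
proof -
  let ?D = "density Q (\<lambda>\<omega>. ennreal (1 + L 1 \<omega>))"
  have [measurable]: "L 1 \<in> borel_measurable Q" by (simp add: L_measurable)
  have L1: "AE \<omega> in Q. 0 \<le> 1 + L 1 \<omega>" by (intro AE_I2) (simp add: add_nonneg_nonneg L_nonneg)
  have fin: "finite_measure ?D"
  proof (rule finite_measureI)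
    have "integrable Q (\<lambda>\<omega>. 1 + L 1 \<omega>)" using L by simp
    then have "(\<integral>\<^sup>+\<omega>. ennreal (1 + L 1 \<omega>) \<partial>Q) < \<infinity>"
      using L1 by (simp add: nn_integral_eq_integral)
    then show "emeasure ?D (space ?D) \<noteq> \<infinity>" by (simp add: emeasure_density cong: nn_integral_cong)
  qed
  note kernel = normalised_occupation_kernel
  have "(\<integral>z. h z \<partial>occupation_measure) = (\<integral>\<omega>. (\<integral>z. h z \<partial>normalised_occupation \<omega>) \<partial>?D)"
    unfolding occupation_measure_def
    by (rule integral_bind_bounded[OF fin normalised_occupation_kernel' h bd])
  also have "\<dots> = (\<integral>\<omega>. (1 + L 1 \<omega>) *\<^sub>R (\<integral>z. h z \<partial>normalised_occupation \<omega>) \<partial>Q)"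
    using L1 measurable_compose[OF kernel integral_measurable_subprob_algebra[OF h]]
    by (intro integral_density) auto
  also have "\<dots> = (\<integral>\<omega>. (LINT s:{0..1}|stieltjes (\<lambda>t. L t \<omega>). h (Z s \<omega>)) \<partial>Q)"
  proof (intro Bochner_Integration.integral_cong refl)
    fix \<omega> assume \<omega>: "\<omega> \<in> space Q"
    have p: "0 \<le> L 1 \<omega>" using L_nonneg[OF \<omega>, of 1] by simp
    have "(\<integral>z. h z \<partial>normalised_occupation \<omega>) = (\<integral>z. (1 / (1 + L 1 \<omega>)) *\<^sub>R h z \<partial>path_occupation \<omega>)"
      unfolding normalised_occupation_def using p
      by (intro integral_density) (auto simp: measurable_cong_sets[OF sets_path_occupation refl])
    then show "(1 + L 1 \<omega>) *\<^sub>R (\<integral>z. h z \<partial>normalised_occupation \<omega>) = (LINT s:{0..1}|stieltjes (\<lambda>t. L t \<omega>). h (Z s \<omega>))"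
      using p by (simp add: integral_path_occupation[OF \<omega> h, symmetric])
  qed
  finally show ?thesis .
qed

text \<open>
  The set function defining \<open>\<nu>\<close> is that of \<open>occupation_measure\<close> on the half-line, read in the
  coordinate \<open>c\<close>; in particular it is countably additive, so that \<^const>\<open>measure_of\<close> does not
  collapse to the zero measure. Since the clock runs only on the half-line, integrals over \<open>\<nu>\<close> are
  integrals over the whole occupation measure.
\<close>

lemma line_integral_occupation_measure:
  fixes e :: "real \<Rightarrow> real \<times> real" and c :: "real \<times> real \<Rightarrow> real" and h :: "real \<times> real \<Rightarrow> complex"
  assumes e: "continuous_on UNIV e" and c: "continuous_on UNIV c" and ce: "\<And>x. c (e x) = x"
    and L: "integrable Q (L 1)" and supp: "AE \<omega> in Q. emeasure (path_occupation \<omega>) (- e ` {..0}) = 0"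
    and h[measurable]: "h \<in> borel_measurable borel" and bd: "\<And>z. norm (h z) \<le> B"
  defines "\<nu> \<equiv> measure_of {..0} (sets (restrict_space borel {..0}))
     (\<lambda>E. \<integral>\<^sup>+\<omega>. (\<integral>\<^sup>+s\<in>{0..1}. indicator (e ` E) (Z s \<omega>) \<partial>stieltjes (\<lambda>t. L t \<omega>)) \<partial>Q)"
  shows "(\<integral>x. h (e x) \<partial>\<nu>) = (\<integral>\<omega>. (LINT s:{0..1}|stieltjes (\<lambda>t. L t \<omega>). h (Z s \<omega>)) \<partial>Q)"
proof -
  let ?H = "e ` {..0}" and ?O = occupation_measure
  have [measurable]: "e \<in> borel_measurable borel" "c \<in> borel_measurable borel"
    using e c by (auto intro: borel_measurable_continuous_onI)
  have H_eq: "?H = {z. c z \<le> 0} \<inter> {z. e (c z) = z}"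
  proof (intro set_eqI iffI)
    fix z assume "z \<in> {z. c z \<le> 0} \<inter> {z. e (c z) = z}"
    then have "z = e (c z)" "c z \<in> {..0}" by auto
    then show "z \<in> ?H" by (rule image_eqI)
  qed (auto simp: ce)
  have "closed {z. e (c z) = z}"
    by (intro closed_Collect_eq continuous_on_compose2[OF e c] continuous_on_id) auto
  then have "closed ?H"
    unfolding H_eq by (intro closed_Int closed_Collect_le c continuous_on_const)
  then have H[measurable]: "?H \<in> sets borel" by (rule borel_closed)
  define N where "N = distr (restrict_space ?O ?H) (restrict_space borel {..0}) c"
  have c_meas: "c \<in> measurable (restrict_space ?O ?H) (restrict_space borel {..0})"
    by (intro measurable_restrict_space3) (auto simp: ce)
  have "\<nu> = measure_of (space N) (sets N) (emeasure N)"
    unfolding \<nu>_def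
  proof (subst measure_of_eq[where \<mu>' = "emeasure N"])
    show "sets (restrict_space borel {..0}) \<subseteq> Pow {..0::real}"
      by (auto simp: sets_restrict_space)
    show "measure_of {..0} (sets (restrict_space borel {..0})) (emeasure N) = measure_of (space N) (sets N) (emeasure N)"
      by (simp add: N_def space_restrict_space)
    fix E assume "E \<in> sigma_sets {..0} (sets (restrict_space borel {..0::real}))"
    then have E: "E \<in> sets (restrict_space borel {..0})"
      using sets.sigma_sets_eq[of "restrict_space borel {..0::real}"] by (simp add: space_restrict_space)
    then have [measurable]: "E \<in> sets borel" and Esub: "E \<subseteq> {..0}"
      by (auto simp: sets_restrict_space)
    have img: "e ` E = c -` E \<inter> ?H" using Esub ce by (auto simp: image_iff)
    then have eE: "e ` E \<in> sets borel" by simp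
    have "emeasure N E = emeasure ?O (e ` E)"
      unfolding N_def img using E c_meas
      by (subst emeasure_distr) (auto simp: emeasure_restrict_space space_restrict_space)
    also have "\<dots> = (\<integral>\<^sup>+\<omega>. (\<integral>\<^sup>+s\<in>{0..1}. indicator (e ` E) (Z s \<omega>) \<partial>stieltjes (\<lambda>t. L t \<omega>)) \<partial>Q)"
      unfolding emeasure_occupation_measure[OF eE]
    proof (intro nn_integral_cong)
      fix \<omega> assume "\<omega> \<in> space Q"
      from nn_integral_path_occupation[OF this, of "indicator (e ` E)"] eE
      show "emeasure (path_occupation \<omega>) (e ` E) = (\<integral>\<^sup>+s\<in>{0..1}. indicator (e ` E) (Z s \<omega>) \<partial>stieltjes (\<lambda>t. L t \<omega>))"
        by (simp add: borel_measurable_indicator)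
    qed
    finally show "(\<integral>\<^sup>+\<omega>. (\<integral>\<^sup>+s\<in>{0..1}. indicator (e ` E) (Z s \<omega>) \<partial>stieltjes (\<lambda>t. L t \<omega>)) \<partial>Q) = emeasure N E" ..
  qed
  also have "\<dots> = N" by (rule measure_of_of_measure)
  finally have \<nu>: "\<nu> = N" .
  have "emeasure ?O (- ?H) = 0"
    using supp by (simp add: emeasure_occupation_measure cong: nn_integral_cong_AE)
  then have onH: "AE z in ?O. z \<in> ?H" by (intro AE_I[of _ _ "- ?H"]) auto
  have "(\<integral>x. h (e x) \<partial>\<nu>) = (\<integral>z. h (e (c z)) \<partial>restrict_space ?O ?H)"
    unfolding \<nu> N_def by (intro integral_distr c_meas measurable_restrict_space1) simp
  also have "\<dots> = (\<integral>z. indicator ?H z *\<^sub>R h (e (c z)) \<partial>?O)"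
    by (rule integral_restrict_space) simp
  also have "\<dots> = (\<integral>z. h z \<partial>?O)"
    using onH by (intro integral_cong_AE) (auto elim!: eventually_mono simp: ce)
  also have "\<dots> = (\<integral>\<omega>. (LINT s:{0..1}|stieltjes (\<lambda>t. L t \<omega>). h (Z s \<omega>)) \<partial>Q)"
    by (rule integral_occupation_measure[OF L h bd])
  finally show ?thesis .
qed

lemma integrable_path_integral:
  fixes h :: "real \<times> real \<Rightarrow> 'b::{banach, second_countable_topology}"
  assumes L: "integrable Q (L 1)" and h: "continuous_on UNIV h" and bd: "\<And>z. norm (h z) \<le> 1"
  shows "integrable Q (\<lambda>\<omega>. LINT s:{0..1}|stieltjes (\<lambda>t. L t \<omega>). h (Z s \<omega>))"
proof -
  have hm: "h \<in> borel_measurable borel" by (rule borel_measurable_continuous_onI[OF h])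
  have "integrable Q (\<lambda>\<omega>. \<integral>z. h z \<partial>path_occupation \<omega>)"
  proof (rule Bochner_Integration.integrable_bound[OF L])
    show "(\<lambda>\<omega>. \<integral>z. h z \<partial>path_occupation \<omega>) \<in> borel_measurable Q"
      by (rule integral_path_occupation_continuous_measurable[OF h])
    show "AE \<omega> in Q. norm (\<integral>z. h z \<partial>path_occupation \<omega>) \<le> norm (L 1 \<omega>)"
    proof (rule AE_I2)
      fix \<omega> assume \<omega>: "\<omega> \<in> space Q"
      interpret O: finite_measure "path_occupation \<omega>" by (rule finite_path_occupation[OF \<omega>])
      have "h \<in> borel_measurable (path_occupation \<omega>)"
        using hm by (simp add: measurable_cong_sets[OF sets_path_occupation refl])
      then have int: "integrable (path_occupation \<omega>) h"
        by (intro O.integrable_const_bound[where B=1]) (simp_all add: bd)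
      have "norm (\<integral>z. h z \<partial>path_occupation \<omega>) \<le> (\<integral>z. norm (h z) \<partial>path_occupation \<omega>)"
        by (rule integral_norm_bound)
      also have "\<dots> \<le> (\<integral>z. 1 \<partial>path_occupation \<omega>)"
        using int bd by (intro integral_mono) auto
      also have "\<dots> = L 1 \<omega>"
        using emeasure_path_occupation_UNIV[OF \<omega>] L_nonneg[OF \<omega>, of 1] by (simp add: measure_def)
      finally show "norm (\<integral>z. h z \<partial>path_occupation \<omega>) \<le> norm (L 1 \<omega>)" by simp
    qed
  qed
  then show ?thesis
    by (rule Bochner_Integration.integrable_cong[THEN iffD1, rotated 2])
       (simp_all add: integral_path_occupation hm)
qed

end

section \<open>The reflected process in stationarity\<close>

definition fourier :: "complex \<Rightarrow> complex \<Rightarrow> real \<times> real \<Rightarrow> complex" where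
  "fourier p q z = exp (p * of_real (fst z) + q * of_real (snd z))"

lemma continuous_on_fourier: "continuous_on A (fourier p q)"
  unfolding fourier_def by (intro continuous_intros)

lemma measurable_fourier [measurable]: "fourier p q \<in> borel_measurable borel"
  by (intro borel_measurable_continuous_onI continuous_on_fourier)

lemma norm_fourier: "Re p = 0 \<Longrightarrow> Re q = 0 \<Longrightarrow> norm (fourier p q z) = 1"
  by (simp add: fourier_def)

lemma measurable_fst_real: "(fst :: real \<times> real \<Rightarrow> real) \<in> borel_measurable borel"
  and measurable_snd_real: "(snd :: real \<times> real \<Rightarrow> real) \<in> borel_measurable borel"
  by (intro borel_measurable_continuous_onI continuous_intros)+

lemma half_line1_eq_image: "half_line1 = (\<lambda>x. (x, 0)) ` {..0}"
  and half_line2_eq_image: "half_line2 = (\<lambda>x. (0, x)) ` {..0}"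
  by (auto simp: half_line1_def half_line2_def)

locale stationary_rbm = reflected_brownian_motion +
  fixes \<pi> :: "(real \<times> real) measure"
  assumes stationary: "stationary_distribution P Z \<pi>"
begin

definition Q :: "'a measure" where "Q = \<pi> \<bind> P"

lemma prob_space_pi: "prob_space \<pi>" and sets_pi: "sets \<pi> = sets tqp_space"
  using stationary by (auto simp: stationary_distribution_def)

lemma space_pi: "space \<pi> = three_quarter_plane"
  using sets_eq_imp_space_eq[OF sets_pi] by (simp add: space_restrict_space)

lemma P_kernel: "P \<in> measurable \<pi> (prob_algebra M)"
  using kernel by (simp add: measurable_cong_sets[OF sets_pi refl])

lemma P_subprob_kernel: "P \<in> measurable \<pi> (subprob_algebra M)"
  by (rule measurable_prob_algebraD[OF P_kernel])

lemma P_x: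
  assumes "x \<in> three_quarter_plane"
  shows "prob_space (P x)" "sets (P x) = sets M" "space (P x) = space M"
proof -
  have "P x \<in> space (prob_algebra M)"
    using measurable_space[OF P_kernel] assms by (simp add: space_pi)
  then show "prob_space (P x)" and *: "sets (P x) = sets M" by (simp_all add: space_prob_algebra)
  from sets_eq_imp_space_eq[OF *] show "space (P x) = space M" .
qed

lemma origin_in: "(0, 0) \<in> three_quarter_plane" by (simp add: three_quarter_plane_def)

lemma Q_space: "prob_space Q" "sets Q = sets M" "space Q = space M"
proof -
  interpret prob_space \<pi> by (rule prob_space_pi)
  show "prob_space Q" unfolding Q_def
    by (rule prob_space_bind[OF _ P_subprob_kernel]) (auto intro!: AE_I2 P_x simp: space_pi)
  show "sets Q = sets M" unfolding Q_def
    using origin_in by (intro sets_bind) (auto simp: P_x space_pi)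
  from sets_eq_imp_space_eq[OF this] show "space Q = space M" .
qed

lemma measurable_Q: "measurable Q N = measurable M N"
  by (rule measurable_cong_sets[OF Q_space(2) refl])

lemma measurable_P_x: "x \<in> three_quarter_plane \<Longrightarrow> measurable (P x) N = measurable M N"
  by (rule measurable_cong_sets[OF P_x(2) refl])

lemma Z_measurable: "0 \<le> t \<Longrightarrow> Z t \<in> borel_measurable M"
  using measurable_from_subalg[OF subalgebra adapted] .

lemma Z_measurable_tqp: "0 \<le> t \<Longrightarrow> Z t \<in> measurable M tqp_space"
  using in_tqp Z_measurable by (intro measurable_restrict_space2) auto

lemma brownian_increment:
  assumes "x \<in> three_quarter_plane" "0 \<le> s" "s < t"
  shows "prob_space.indep_set (P x) (sets (F s))
          (sets (vimage_algebra (space (P x)) (\<lambda>\<omega>. W t \<omega> - W s \<omega>) borel))"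
    and "(a, b) \<noteq> (0, 0) \<Longrightarrow> distributed (P x) lborel (\<lambda>\<omega>. a * fst (W t \<omega> - W s \<omega>) + b * snd (W t \<omega> - W s \<omega>))
             (normal_density 0 (sqrt ((t - s) * (\<sigma>1 * a\<^sup>2 + 2 * \<rho> * a * b + \<sigma>2 * b\<^sup>2))))"
proof -
  from brownian[OF assms(1)] have *: "\<forall>s t. 0 \<le> s \<and> s < t \<longrightarrow>
        prob_space.indep_set (P x) (sets (F s))
          (sets (vimage_algebra (space (P x)) (\<lambda>\<omega>. W t \<omega> - W s \<omega>) borel)) \<and>
        (\<forall>a b. (a, b) \<noteq> (0, 0) \<longrightarrow>
           distributed (P x) lborel (\<lambda>\<omega>. a * fst (W t \<omega> - W s \<omega>) + b * snd (W t \<omega> - W s \<omega>))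
             (normal_density 0 (sqrt ((t - s) * (\<sigma>1 * a\<^sup>2 + 2 * \<rho> * a * b + \<sigma>2 * b\<^sup>2)))))"
    unfolding planar_brownian_motion_def by (elim conjE)
  note ** = *[THEN spec, THEN spec, THEN mp, OF conjI, OF assms(2,3)]
  show "prob_space.indep_set (P x) (sets (F s))
          (sets (vimage_algebra (space (P x)) (\<lambda>\<omega>. W t \<omega> - W s \<omega>) borel))"
    by (rule **[THEN conjunct1])
  show "(a, b) \<noteq> (0, 0) \<Longrightarrow> distributed (P x) lborel (\<lambda>\<omega>. a * fst (W t \<omega> - W s \<omega>) + b * snd (W t \<omega> - W s \<omega>))
             (normal_density 0 (sqrt ((t - s) * (\<sigma>1 * a\<^sup>2 + 2 * \<rho> * a * b + \<sigma>2 * b\<^sup>2))))"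
    by (rule **[THEN conjunct2, THEN spec, THEN spec, THEN mp])
qed

lemma W_measurable: "0 \<le> t \<Longrightarrow> W t \<in> borel_measurable M"
  using brownian[OF origin_in] measurable_from_subalg[OF subalgebra]
  unfolding planar_brownian_motion_def by blast

lemma Z_law: "0 \<le> t \<Longrightarrow> distr Q tqp_space (Z t) = \<pi>"
  unfolding Q_def
  using distr_bind[OF P_subprob_kernel _ Z_measurable_tqp, of t] stationary prob_space.not_empty[OF prob_space_pi]
  by (simp add: stationary_distribution_def transition_kernel_def[abs_def])

text \<open>
  The exceptional null set may depend on the starting point; measurability of the event is what
  allows integrating over the starting point.
\<close>

lemma AE_Q:
  assumes "Measurable.pred M \<phi>" "\<And>x. x \<in> three_quarter_plane \<Longrightarrow> AE \<omega> in P x. \<phi> \<omega>"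
  shows "AE \<omega> in Q. \<phi> \<omega>"
  unfolding Q_def AE_bind[OF P_subprob_kernel assms(1)]
  by (intro AE_I2 assms(2)) (simp add: space_pi)

lemma occupation_local_time:
  assumes "\<And>x. x \<in> three_quarter_plane \<Longrightarrow> boundary_local_time (P x) F Z H L"
  shows "occupation Q Z L"
proof -
  have L: "\<forall>t\<ge>0. L t \<in> borel_measurable (F t)"
      "\<forall>\<omega>\<in>space M. continuous_on {0..} (\<lambda>t. L t \<omega>) \<and> mono_on {0..} (\<lambda>t. L t \<omega>) \<and> L 0 \<omega> = 0"
    using assms[OF origin_in] P_x[OF origin_in] unfolding boundary_local_time_def by auto
  show ?thesis
  proof (rule occupation.intro)
    show "Z t \<in> borel_measurable Q" "L t \<in> borel_measurable Q" if "0 \<le> t" for t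
      using that L(1) measurable_from_subalg[OF subalgebra] Z_measurable unfolding measurable_Q by auto
    show "prob_space Q" by (rule Q_space)
    fix \<omega> assume "\<omega> \<in> space Q"
    then have \<omega>: "\<omega> \<in> space M" by (simp add: Q_space)
    show "continuous_on {0..} (\<lambda>t. Z t \<omega>)" by (rule continuous[OF \<omega>])
    show "continuous_on {0..} (\<lambda>t. L t \<omega>)" "mono_on {0..} (\<lambda>t. L t \<omega>)" "L 0 \<omega> = 0"
      using L(2) \<omega> by blast+
  qed
qed

lemma occupation_support:
  assumes LT: "\<And>x. x \<in> three_quarter_plane \<Longrightarrow> boundary_local_time (P x) F Z H L" and H: "closed H"
  shows "AE \<omega> in Q. emeasure (occupation.path_occupation Z L \<omega>) (- H) = 0"
proof -
  interpret occupation Q Z L by (rule occupation_local_time[OF LT])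
  have HB: "- H \<in> sets borel" using H by (auto intro: borel_open)
  have [measurable]: "(\<lambda>\<omega>. emeasure (path_occupation \<omega>) (- H)) \<in> borel_measurable M"
    using emeasure_path_occupation_measurable[OF HB] by (simp add: measurable_Q)
  show ?thesis
  proof (rule AE_Q)
    show "Measurable.pred M (\<lambda>\<omega>. emeasure (path_occupation \<omega>) (- H) = 0)" by measurable
    fix x assume x: "x \<in> three_quarter_plane"
    have "AE \<omega> in P x. AE s in stieltjes (\<lambda>t. L t \<omega>). 0 \<le> s \<longrightarrow> Z s \<omega> \<in> H"
      using LT[OF x] by (simp add: boundary_local_time_def)
    then show "AE \<omega> in P x. emeasure (path_occupation \<omega>) (- H) = 0"
      using AE_space
    proof eventually_elim
      case (elim \<omega>)
      then have "\<omega> \<in> space Q" by (simp add: P_x[OF x] Q_space)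
      then have "emeasure (path_occupation \<omega>) (- H) =
          (\<integral>\<^sup>+s\<in>{0..1}. indicator (- H) (Z s \<omega>) \<partial>stieltjes (\<lambda>t. L t \<omega>))"
        using nn_integral_path_occupation[of \<omega> "indicator (- H)"] HB by simp
      also have "\<dots> = (\<integral>\<^sup>+s. 0 \<partial>stieltjes (\<lambda>t. L t \<omega>))"
        using elim(1) by (intro nn_integral_cong_AE) (auto elim!: eventually_mono simp: indicator_def)
      finally show ?case by simp
    qed
  qed
qed

sublocale L1: occupation Q Z L1 by (rule occupation_local_time[OF local_time1])
sublocale L2: occupation Q Z L2 by (rule occupation_local_time[OF local_time2])

lemma L_measurable_M: "0 \<le> t \<Longrightarrow> L1 t \<in> borel_measurable M" "0 \<le> t \<Longrightarrow> L2 t \<in> borel_measurable M"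
  using L1.L_measurable L2.L_measurable by (simp_all add: measurable_Q)

lemma equation_Q:
  assumes "0 \<le> t"
  shows "AE \<omega> in Q. fst (Z t \<omega>) = fst (Z 0 \<omega>) + fst (W t \<omega>) + \<mu>1 * t + r1 * L1 t \<omega> + L2 t \<omega> \<and>
        snd (Z t \<omega>) = snd (Z 0 \<omega>) + snd (W t \<omega>) + \<mu>2 * t + L1 t \<omega> + r2 * L2 t \<omega>"
proof (rule AE_Q)
  have [measurable]: "Z t \<in> borel_measurable M" "Z 0 \<in> borel_measurable M" "W t \<in> borel_measurable M"
    "L1 t \<in> borel_measurable M" "L2 t \<in> borel_measurable M"
    using assms by (auto intro: Z_measurable W_measurable L_measurable_M)
  note measurable_compose[OF _ measurable_fst_real, measurable (raw)] measurable_compose[OF _ measurable_snd_real, measurable (raw)]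
  show "Measurable.pred M (\<lambda>\<omega>. fst (Z t \<omega>) = fst (Z 0 \<omega>) + fst (W t \<omega>) + \<mu>1 * t + r1 * L1 t \<omega> + L2 t \<omega> \<and>
        snd (Z t \<omega>) = snd (Z 0 \<omega>) + snd (W t \<omega>) + \<mu>2 * t + L1 t \<omega> + r2 * L2 t \<omega>)"
    by measurable
  show "AE \<omega> in P x. fst (Z t \<omega>) = fst (Z 0 \<omega>) + fst (W t \<omega>) + \<mu>1 * t + r1 * L1 t \<omega> + L2 t \<omega> \<and>
        snd (Z t \<omega>) = snd (Z 0 \<omega>) + snd (W t \<omega>) + \<mu>2 * t + L1 t \<omega> + r2 * L2 t \<omega>"
    if "x \<in> three_quarter_plane" for x
    using equation[OF that] by eventually_elim (use assms in blast)
qed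

lemma plane_transform_eq:
  assumes "0 \<le> t"
  shows "(\<integral>\<omega>. fourier p q (Z t \<omega>) \<partial>Q) = plane_transform \<pi> p q"
proof -
  have "plane_transform \<pi> p q = (\<integral>z. fourier p q z \<partial>distr Q tqp_space (Z t))"
    unfolding Z_law[OF assms] plane_transform_def fourier_def ..
  also have "\<dots> = (\<integral>\<omega>. fourier p q (Z t \<omega>) \<partial>Q)"
    using Z_measurable_tqp[OF assms]
    by (intro integral_distr) (simp_all add: measurable_Q measurable_restrict_space1)
  finally show ?thesis ..
qed

lemma equal_coordinate_laws:
  assumes "0 \<le> s" "0 \<le> t" "c \<in> borel_measurable borel"
  shows "distr Q borel (\<lambda>\<omega>. c (Z s \<omega>)) = distr Q borel (\<lambda>\<omega>. c (Z t \<omega>))"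
proof -
  have "distr Q borel (\<lambda>\<omega>. c (Z t \<omega>)) = distr \<pi> borel c" if "0 \<le> t" for t
    using distr_distr[of c tqp_space borel "Z t" Q] Z_measurable_tqp[OF that] assms(3) Z_law[OF that]
    by (simp add: measurable_Q measurable_restrict_space1 comp_def)
  then show ?thesis using assms by simp
qed

lemma integrable_brownian_increment:
  assumes \<sigma>: "0 < \<sigma>1"
  shows "integrable Q (\<lambda>\<omega>. fst (W 1 \<omega> - W 0 \<omega>))"
proof -
  have [measurable]: "W 1 \<in> borel_measurable M" "W 0 \<in> borel_measurable M"
    by (auto intro: W_measurable)
  note measurable_compose[OF _ measurable_fst_real, measurable (raw)]
  define C where "C = (\<integral>\<^sup>+x. ennreal (normal_density 0 (sqrt \<sigma>1) x) * ennreal \<bar>x\<bar> \<partial>lborel)"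
  have X: "(\<integral>\<^sup>+\<omega>. ennreal \<bar>fst (W 1 \<omega> - W 0 \<omega>)\<bar> \<partial>P x) = C \<and> C < \<infinity>" if x: "x \<in> three_quarter_plane" for x
  proof -
    interpret prob_space "P x" by (rule P_x[OF x])
    have "distributed (P x) lborel (\<lambda>\<omega>. 1 * fst (W 1 \<omega> - W 0 \<omega>) + 0 * snd (W 1 \<omega> - W 0 \<omega>))
             (normal_density 0 (sqrt ((1 - 0) * (\<sigma>1 * 1\<^sup>2 + 2 * \<rho> * 1 * 0 + \<sigma>2 * 0\<^sup>2))))"
      by (rule brownian_increment[OF x]) auto
    then have D: "distributed (P x) lborel (\<lambda>\<omega>. fst (W 1 \<omega> - W 0 \<omega>)) (normal_density 0 (sqrt \<sigma>1))" by simp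
    show ?thesis unfolding C_def using normal_absolute_moment[OF D] \<sigma> by simp
  qed
  have "(\<integral>\<^sup>+\<omega>. ennreal \<bar>fst (W 1 \<omega> - W 0 \<omega>)\<bar> \<partial>Q) = (\<integral>\<^sup>+x. \<integral>\<^sup>+\<omega>. ennreal \<bar>fst (W 1 \<omega> - W 0 \<omega>)\<bar> \<partial>P x \<partial>\<pi>)"
    unfolding Q_def by (rule nn_integral_bind[OF _ P_subprob_kernel]) measurable
  also have "\<dots> = (\<integral>\<^sup>+x. C \<partial>\<pi>)" using X by (intro nn_integral_cong) (simp add: space_pi)
  also have "\<dots> = C" using prob_space.emeasure_space_1[OF prob_space_pi] by simp
  also have "\<dots> < \<infinity>" using X[OF origin_in] by simp
  finally show ?thesis by (simp add: integrable_iff_bounded measurable_Q)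
qed

text \<open>
  The equation gives \<open>fst (Z 1) - fst (Z 0) = (fst (W 1) - fst (W 0)) + \<mu>1 + (r1 * L1 1 + L2 1)\<close>.
  The last bracket is nonnegative, so the increment dominates an integrable variable, and its two
  terms on the left have the same law by stationarity. Hence the increment is integrable even if
  \<open>\<pi>\<close> has no moments, and with it both local times.
\<close>

lemma integrable_local_times:
  assumes \<sigma>: "0 < \<sigma>1" and r: "0 < r1"
  shows "integrable Q (L1 1)" "integrable Q (L2 1)"
proof -
  interpret prob_space Q by (rule Q_space)
  have [measurable]: "Z 1 \<in> borel_measurable Q" "Z 0 \<in> borel_measurable Q" "W 1 \<in> borel_measurable Q"
    "W 0 \<in> borel_measurable Q" "L1 1 \<in> borel_measurable Q" "L2 1 \<in> borel_measurable Q"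
    by (auto simp: measurable_Q intro: Z_measurable W_measurable L_measurable_M)
  note measurable_compose[OF _ measurable_fst_real, measurable (raw)]
  let ?g = "\<lambda>\<omega>. fst (W 1 \<omega> - W 0 \<omega>) + \<mu>1"
  have g: "integrable Q ?g" using integrable_brownian_increment[OF \<sigma>] by simp
  have eq: "AE \<omega> in Q. r1 * L1 1 \<omega> + L2 1 \<omega> = (fst (Z 1 \<omega>) - fst (Z 0 \<omega>)) - ?g \<omega>"
    using equation_Q[OF zero_le_one] equation_Q[OF order_refl] AE_space
    by eventually_elim (auto simp: L1.L_0 L2.L_0)
  have pos: "0 \<le> L1 1 \<omega>" "0 \<le> L2 1 \<omega>" if "\<omega> \<in> space Q" for \<omega>
    using that by (auto intro: L1.L_nonneg L2.L_nonneg)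
  have "AE \<omega> in Q. ?g \<omega> \<le> fst (Z 1 \<omega>) - fst (Z 0 \<omega>)"
    using eq AE_space
  proof eventually_elim
    case (elim \<omega>)
    have "0 \<le> r1 * L1 1 \<omega> + L2 1 \<omega>" using pos[OF elim(2)] r by simp
    then show ?case using elim(1) by linarith
  qed
  then have "integrable Q (\<lambda>\<omega>. fst (Z 1 \<omega>) - fst (Z 0 \<omega>))"
    by (intro prob_space.integrable_increment_of_equal_laws[OF Q_space(1) _ _ equal_coordinate_laws[OF _ _ measurable_fst_real] g]) auto
  then have "integrable Q (\<lambda>\<omega>. (fst (Z 1 \<omega>) - fst (Z 0 \<omega>)) - ?g \<omega>)" using g by (rule Bochner_Integration.integrable_diff)
  then have int: "integrable Q (\<lambda>\<omega>. r1 * L1 1 \<omega> + L2 1 \<omega>)"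
    by (rule integrable_cong_AE[THEN iffD2, rotated 3]) (use eq in auto)
  show "integrable Q (L2 1)"
    by (rule Bochner_Integration.integrable_bound[OF int]) (use pos r in \<open>auto intro!: AE_I2\<close>)
  show "integrable Q (L1 1)"
    by (rule Bochner_Integration.integrable_bound[OF integrable_mult_right[OF int, of "1 / r1"]])
       (use pos r in \<open>auto intro!: AE_I2 simp: field_simps\<close>)
qed

lemma line_transforms:
  assumes "integrable Q (L1 1)" "integrable Q (L2 1)" and p: "Re p = 0" and q: "Re q = 0"
  shows "line_transform (boundary_measure1 P Z L1 \<pi>) p
      = (\<integral>\<omega>. (LINT s:{0..1}|stieltjes (\<lambda>t. L1 t \<omega>). fourier p q (Z s \<omega>)) \<partial>Q)"
    and "line_transform (boundary_measure2 P Z L2 \<pi>) q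
      = (\<integral>\<omega>. (LINT s:{0..1}|stieltjes (\<lambda>t. L2 t \<omega>). fourier p q (Z s \<omega>)) \<partial>Q)"
proof -
  have bd: "norm (fourier p q z) \<le> 1" for z using norm_fourier[OF p q] by simp
  have H: "closed half_line1" "closed half_line2"
    unfolding half_line1_def half_line2_def by (intro closed_Times closed_atMost closed_singleton)+
  have E: "E \<times> {0} = (\<lambda>x. (x, 0)) ` E" "{0} \<times> E = (\<lambda>x. (0, x)) ` E" for E :: "real set" by auto
  have "(\<integral>x. fourier p q (x, 0) \<partial>boundary_measure1 P Z L1 \<pi>)
      = (\<integral>\<omega>. (LINT s:{0..1}|stieltjes (\<lambda>t. L1 t \<omega>). fourier p q (Z s \<omega>)) \<partial>Q)"
    unfolding boundary_measure1_def E Q_def[symmetric]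
  proof (rule L1.line_integral_occupation_measure[where c=fst and B=1])
    show "AE \<omega> in Q. emeasure (L1.path_occupation \<omega>) (- (\<lambda>x. (x, 0)) ` {..0}) = 0"
      using occupation_support[OF local_time1 H(1)] by (simp add: half_line1_eq_image)
  qed (auto intro!: continuous_intros assms bd)
  then show "line_transform (boundary_measure1 P Z L1 \<pi>) p
      = (\<integral>\<omega>. (LINT s:{0..1}|stieltjes (\<lambda>t. L1 t \<omega>). fourier p q (Z s \<omega>)) \<partial>Q)"
    by (simp add: line_transform_def fourier_def)
  have "(\<integral>x. fourier p q (0, x) \<partial>boundary_measure2 P Z L2 \<pi>)
      = (\<integral>\<omega>. (LINT s:{0..1}|stieltjes (\<lambda>t. L2 t \<omega>). fourier p q (Z s \<omega>)) \<partial>Q)"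
    unfolding boundary_measure2_def E Q_def[symmetric]
  proof (rule L2.line_integral_occupation_measure[where c=snd and B=1])
    show "AE \<omega> in Q. emeasure (L2.path_occupation \<omega>) (- (\<lambda>x. (0, x)) ` {..0}) = 0"
      using occupation_support[OF local_time2 H(2)] by (simp add: half_line2_eq_image)
  qed (auto intro!: continuous_intros assms bd)
  then show "line_transform (boundary_measure2 P Z L2 \<pi>) q
      = (\<integral>\<omega>. (LINT s:{0..1}|stieltjes (\<lambda>t. L2 t \<omega>). fourier p q (Z s \<omega>)) \<partial>Q)"
    by (simp add: line_transform_def fourier_def)
qed

section \<open>The functional equation\<close>

text \<open>
  Under each \<open>P x\<close> the increment is independent of the past and Gaussian, so its characteristic
  function factors out before averaging over \<open>x\<close>. The pair \<open>(0, 0)\<close> is excluded because the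
  Gaussian then degenerates and has no density.
\<close>

lemma expectation_fourier_brownian_increment:
  assumes \<sigma>: "0 < \<sigma>1" "0 < \<sigma>1 * \<sigma>2 - \<rho>\<^sup>2"
    and p: "Re p = 0" and q: "Re q = 0" and st: "0 \<le> s" "s < t" and pq: "(p, q) \<noteq> (0, 0)"
  shows "(\<integral>\<omega>. fourier p q (Z s \<omega>) * fourier p q (W t \<omega> - W s \<omega>) \<partial>Q)
    = exp (of_real (t - s) * (1 / 2 * (of_real \<sigma>1 * p\<^sup>2 + 2 * of_real \<rho> * p * q + of_real \<sigma>2 * q\<^sup>2)))
        * plane_transform \<pi> p q"
proof -
  define a b where "a = Im p" and "b = Im q"
  have pa: "p = \<i> * of_real a" "q = \<i> * of_real b" using p q by (auto simp: a_def b_def complex_eq_iff)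
  then have ab: "(a, b) \<noteq> (0, 0)" using pq by auto
  define v where "v = \<sigma>1 * a\<^sup>2 + 2 * \<rho> * a * b + \<sigma>2 * b\<^sup>2"
  \<comment> \<open>Completing the square shows that the covariance form is positive definite.\<close>
  have "\<sigma>1 * v = (\<sigma>1 * a + \<rho> * b)\<^sup>2 + (\<sigma>1 * \<sigma>2 - \<rho>\<^sup>2) * b\<^sup>2"
    by (simp add: v_def power2_eq_square algebra_simps)
  also have "\<dots> > 0"
  proof (cases "b = 0")
    case True
    then show ?thesis using ab \<sigma> by simp
  next
    case False
    then show ?thesis using \<sigma> by (intro add_nonneg_pos) auto
  qed
  finally have v: "0 < v" using \<sigma>(1) by (simp add: zero_less_mult_iff)
  let ?E = "exp (of_real (t - s) * (1 / 2 * (of_real \<sigma>1 * p\<^sup>2 + 2 * of_real \<rho> * p * q + of_real \<sigma>2 * q\<^sup>2)))"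
  have E_eq: "?E = complex_of_real (exp (- (t - s) * v / 2))"
    unfolding exp_of_real[symmetric] v_def pa by (intro arg_cong[where f=exp]) (simp add: power2_eq_square field_simps)
  have t: "0 \<le> t" using st by simp
  have meas[measurable]: "Z s \<in> borel_measurable M" "W s \<in> borel_measurable M" "W t \<in> borel_measurable M"
    using st by (auto intro: Z_measurable W_measurable)
  have X: "(\<integral>\<omega>. fourier p q (Z s \<omega>) * fourier p q (W t \<omega> - W s \<omega>) \<partial>P x)
      = (\<integral>\<omega>. fourier p q (Z s \<omega>) \<partial>P x) * ?E" if x: "x \<in> three_quarter_plane" for x
  proof -
    interpret prob_space "P x" by (rule P_x[OF x])
    have sub: "subalgebra (P x) (F s)"
      using subalgebra[OF st(1)] by (simp add: subalgebra_def P_x[OF x])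
    have [measurable]: "Z s \<in> borel_measurable (P x)" "W s \<in> borel_measurable (P x)" "W t \<in> borel_measurable (P x)"
      using meas by (simp_all add: measurable_P_x[OF x])
    have U: "(\<lambda>\<omega>. fourier p q (Z s \<omega>)) \<in> borel_measurable (F s)"
      by (rule measurable_compose[OF adapted[OF st(1)] measurable_fourier])
    have "(\<integral>\<omega>. fourier p q (Z s \<omega>) * fourier p q (W t \<omega> - W s \<omega>) \<partial>P x)
        = (\<integral>\<omega>. fourier p q (Z s \<omega>) \<partial>P x) * (\<integral>\<omega>. fourier p q (W t \<omega> - W s \<omega>) \<partial>P x)"
      by (rule expectation_mult_indep_sigma[OF sub brownian_increment(1)[OF x st] U _ _ measurable_fourier])
         (auto intro!: integrable_const_bound[where B=1] simp: norm_fourier[OF p q])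
    also have "(\<integral>\<omega>. fourier p q (W t \<omega> - W s \<omega>) \<partial>P x)
        = (\<integral>\<omega>. exp (\<i> * complex_of_real (a * fst (W t \<omega> - W s \<omega>) + b * snd (W t \<omega> - W s \<omega>))) \<partial>P x)"
      unfolding fourier_def pa by (simp add: algebra_simps)
    also have "\<dots> = complex_of_real (exp (- (sqrt ((t - s) * v))\<^sup>2 / 2))"
      by (rule expectation_iexp_normal[OF brownian_increment(2)[OF x st ab, folded v_def]]) (use st v in simp)
    also have "\<dots> = ?E" unfolding E_eq using st v by (simp add: algebra_simps)
    finally show ?thesis .
  qed
  have B: "norm (fourier p q (Z s \<omega>) * fourier p q (W t \<omega> - W s \<omega>)) \<le> 1" "norm (fourier p q (Z s \<omega>)) \<le> 1" for \<omega>
    by (simp_all add: norm_mult norm_fourier[OF p q])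
  note bind = integral_bind_bounded(1)[OF prob_space.finite_measure[OF prob_space_pi] P_subprob_kernel, folded Q_def]
  have "(\<integral>\<omega>. fourier p q (Z s \<omega>) * fourier p q (W t \<omega> - W s \<omega>) \<partial>Q)
      = (\<integral>x. (\<integral>\<omega>. fourier p q (Z s \<omega>) * fourier p q (W t \<omega> - W s \<omega>) \<partial>P x) \<partial>\<pi>)"
    by (rule bind[OF _ B(1)]) measurable
  also have "\<dots> = (\<integral>x. (\<integral>\<omega>. fourier p q (Z s \<omega>) \<partial>P x) * ?E \<partial>\<pi>)"
    by (intro Bochner_Integration.integral_cong refl X) (simp add: space_pi)
  also have "\<dots> = (\<integral>x. (\<integral>\<omega>. fourier p q (Z s \<omega>) \<partial>P x) \<partial>\<pi>) * ?E" by simp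
  also have "(\<integral>x. (\<integral>\<omega>. fourier p q (Z s \<omega>) \<partial>P x) \<partial>\<pi>) = (\<integral>\<omega>. fourier p q (Z s \<omega>) \<partial>Q)"
    by (rule bind[OF _ B(2), symmetric]) measurable
  also have "\<dots> = plane_transform \<pi> p q" by (rule plane_transform_eq[OF st(1)])
  finally show ?thesis by (simp add: mult.commute)
qed

text \<open>
  Cancelling the boundary pushes over \<open>[s, t]\<close> from \<open>Z t\<close> leaves \<open>Z s\<close>, a Brownian increment and
  the drift; the characteristic exponent of the latter two is exactly \<^const>\<open>kernel_K\<close>.
\<close>

lemma expectation_fourier_push_removed:
  assumes \<sigma>: "0 < \<sigma>1" "0 < \<sigma>1 * \<sigma>2 - \<rho>\<^sup>2"
    and p: "Re p = 0" and q: "Re q = 0" and st: "0 \<le> s" "s < t" and pq: "(p, q) \<noteq> (0, 0)"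
  shows "(\<integral>\<omega>. fourier p q (Z t \<omega>) *
      exp (- (coeff_u r1 p q * of_real (L1 t \<omega> - L1 s \<omega>) + coeff_v r2 p q * of_real (L2 t \<omega> - L2 s \<omega>))) \<partial>Q)
    = exp (of_real (t - s) * kernel_K \<sigma>1 \<rho> \<sigma>2 \<mu>1 \<mu>2 p q) * plane_transform \<pi> p q"
proof -
  have t: "0 \<le> t" using st by simp
  have [measurable]: "Z s \<in> borel_measurable Q" "W s \<in> borel_measurable Q" "W t \<in> borel_measurable Q"
    "Z t \<in> borel_measurable Q" "L1 s \<in> borel_measurable Q" "L1 t \<in> borel_measurable Q"
    "L2 s \<in> borel_measurable Q" "L2 t \<in> borel_measurable Q"
    using st t by (auto simp: measurable_Q intro: Z_measurable W_measurable L_measurable_M)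
  let ?d = "exp (of_real (t - s) * (of_real \<mu>1 * p + of_real \<mu>2 * q))"
  have "(\<integral>\<omega>. fourier p q (Z t \<omega>) *
      exp (- (coeff_u r1 p q * of_real (L1 t \<omega> - L1 s \<omega>) + coeff_v r2 p q * of_real (L2 t \<omega> - L2 s \<omega>))) \<partial>Q)
    = (\<integral>\<omega>. ?d * (fourier p q (Z s \<omega>) * fourier p q (W t \<omega> - W s \<omega>)) \<partial>Q)"
  proof (rule integral_cong_AE)
    show "AE \<omega> in Q. fourier p q (Z t \<omega>) *
      exp (- (coeff_u r1 p q * of_real (L1 t \<omega> - L1 s \<omega>) + coeff_v r2 p q * of_real (L2 t \<omega> - L2 s \<omega>)))
      = ?d * (fourier p q (Z s \<omega>) * fourier p q (W t \<omega> - W s \<omega>))"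
      using equation_Q[OF st(1)] equation_Q[OF t]
    proof eventually_elim
      case (elim \<omega>)
      have 1: "fst (Z t \<omega>) = fst (Z s \<omega>) + fst (W t \<omega> - W s \<omega>) + \<mu>1 * (t - s) + r1 * (L1 t \<omega> - L1 s \<omega>) + (L2 t \<omega> - L2 s \<omega>)"
        using elim by (simp add: algebra_simps)
      have 2: "snd (Z t \<omega>) = snd (Z s \<omega>) + snd (W t \<omega> - W s \<omega>) + \<mu>2 * (t - s) + (L1 t \<omega> - L1 s \<omega>) + r2 * (L2 t \<omega> - L2 s \<omega>)"
        using elim by (simp add: algebra_simps)
      show ?case
        unfolding fourier_def 1 2 exp_add[symmetric] coeff_u_def coeff_v_def
        by (intro arg_cong[where f=exp]) (simp add: algebra_simps)
    qed
  qed measurable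
  also have "\<dots> = ?d * (exp (of_real (t - s) * (1 / 2 * (of_real \<sigma>1 * p\<^sup>2 + 2 * of_real \<rho> * p * q + of_real \<sigma>2 * q\<^sup>2)))
        * plane_transform \<pi> p q)"
    by (simp only: integral_mult_right_zero expectation_fourier_brownian_increment[OF assms])
  also have "\<dots> = exp (of_real (t - s) * kernel_K \<sigma>1 \<rho> \<sigma>2 \<mu>1 \<mu>2 p q) * plane_transform \<pi> p q"
    unfolding mult.assoc[symmetric] exp_add[symmetric] kernel_K_def
    by (intro arg_cong2[where f="(*)"] arg_cong[where f=exp] refl) (simp add: field_simps)
  finally show ?thesis .
qed

text \<open>
  Let \<open>S n\<close> add up, over a grid of mesh \<open>1 / n\<close>, the changes of \<open>fourier p q (Z t)\<close> caused by
  removing the pushes of the current cell. By stationarity and the preceding lemma its mean is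
  \<open>n * (1 - exp (K / n))\<close> times the transform of \<open>\<pi>\<close>, whereas pathwise it converges to the
  boundary integrals; the integrable bound \<open>c * (L1 1 + L2 1)\<close> lets both limits be compared.
\<close>

theorem functional_equation:
  assumes \<sigma>: "0 < \<sigma>1" "0 < \<sigma>1 * \<sigma>2 - \<rho>\<^sup>2" and r: "0 < r1"
    and p: "Re p = 0" and q: "Re q = 0"
  shows "kernel_K \<sigma>1 \<rho> \<sigma>2 \<mu>1 \<mu>2 p q * plane_transform \<pi> p q
         + coeff_u r1 p q * line_transform (boundary_measure1 P Z L1 \<pi>) p
         + coeff_v r2 p q * line_transform (boundary_measure2 P Z L2 \<pi>) q = 0"
proof (cases "(p, q) = (0, 0)")
  case True
  then show ?thesis by (simp add: kernel_K_def coeff_u_def coeff_v_def)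
next
  case pq: False
  let ?K = "kernel_K \<sigma>1 \<rho> \<sigma>2 \<mu>1 \<mu>2 p q"
  let ?u = "coeff_u r1 p q" and ?v = "coeff_v r2 p q"
  let ?A1 = "\<lambda>\<omega>. LINT s:{0..1}|stieltjes (\<lambda>t. L1 t \<omega>). fourier p q (Z s \<omega>)"
  let ?A2 = "\<lambda>\<omega>. LINT s:{0..1}|stieltjes (\<lambda>t. L2 t \<omega>). fourier p q (Z s \<omega>)"
  let ?t = "\<lambda>n k. real k / real n"
  define w where "w n k \<omega> = ?u * of_real (L1 (?t n (Suc k)) \<omega> - L1 (?t n k) \<omega>)
      + ?v * of_real (L2 (?t n (Suc k)) \<omega> - L2 (?t n k) \<omega>)" for n k \<omega>
  define S where "S n \<omega> = (\<Sum>k<n. fourier p q (Z (?t n (Suc k)) \<omega>) * (1 - exp (- w n k \<omega>)))" for n \<omega>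
  have uv: "Re ?u = 0" "Re ?v = 0" using p q by (simp_all add: coeff_u_def coeff_v_def)
  have Re_w: "Re (w n k \<omega>) = 0" for n k \<omega> using uv by (simp add: w_def)
  have meas[measurable]: "Z (?t n k) \<in> borel_measurable Q" "L1 (?t n k) \<in> borel_measurable Q" "L2 (?t n k) \<in> borel_measurable Q"
    for n k by (auto simp: measurable_Q intro: Z_measurable L_measurable_M)
  have [measurable]: "w n k \<in> borel_measurable Q" for n k unfolding w_def by measurable
  have [measurable]: "S n \<in> borel_measurable Q" for n unfolding S_def by measurable
  note int = integrable_local_times[OF \<sigma>(1) r]
  have A: "integrable Q ?A1" "integrable Q ?A2"
    using L1.integrable_path_integral[OF int(1) continuous_on_fourier] L2.integrable_path_integral[OF int(2) continuous_on_fourier]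
    by (simp_all add: norm_fourier[OF p q])
  define c where "c = norm ?u + norm ?v"
  have "(\<lambda>n. \<integral>\<omega>. S n \<omega> \<partial>Q) \<longlonglongrightarrow> (\<integral>\<omega>. ?u * ?A1 \<omega> + ?v * ?A2 \<omega> \<partial>Q)"
  proof (rule integral_dominated_convergence[where w="\<lambda>\<omega>. c * (L1 1 \<omega> + L2 1 \<omega>)"])
    show "integrable Q (\<lambda>\<omega>. c * (L1 1 \<omega> + L2 1 \<omega>))" using int by simp
    show lim: "AE \<omega> in Q. (\<lambda>n. S n \<omega>) \<longlonglongrightarrow> ?u * ?A1 \<omega> + ?v * ?A2 \<omega>"
    proof (rule AE_I2)
      fix \<omega> assume \<omega>: "\<omega> \<in> space Q"
      have "continuous_on {0..1} (\<lambda>s. fourier p q (Z s \<omega>))"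
        by (rule continuous_on_compose2[OF continuous_on_fourier[of UNIV] continuous_on_subset[OF L1.Z_continuous[OF \<omega>]]]) auto
      from exponential_sums_tendsto_stieltjes[OF L1.L_continuous[OF \<omega>] L1.L_mono[OF \<omega>] L2.L_continuous[OF \<omega>] L2.L_mono[OF \<omega>] this uv]
      show "(\<lambda>n. S n \<omega>) \<longlonglongrightarrow> ?u * ?A1 \<omega> + ?v * ?A2 \<omega>" unfolding S_def w_def .
    qed
    show "(\<lambda>\<omega>. ?u * ?A1 \<omega> + ?v * ?A2 \<omega>) \<in> borel_measurable Q"
      using A by simp
    show "AE \<omega> in Q. norm (S n \<omega>) \<le> c * (L1 1 \<omega> + L2 1 \<omega>)" for n
    proof (rule AE_I2)
      fix \<omega> assume \<omega>: "\<omega> \<in> space Q"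
      let ?d = "\<lambda>L k. L (?t n (Suc k)) \<omega> - L (?t n k) \<omega>"
      have d: "0 \<le> ?d L1 k" "0 \<le> ?d L2 k" for k
        by (auto intro!: mono_onD[OF L1.L_mono[OF \<omega>]] mono_onD[OF L2.L_mono[OF \<omega>]] simp: divide_right_mono)
      have "norm (S n \<omega>) \<le> (\<Sum>k<n. c * (?d L1 k + ?d L2 k))"
        unfolding S_def
      proof (rule sum_norm_le)
        fix k
        have "norm (fourier p q (Z (?t n (Suc k)) \<omega>) * (1 - exp (- w n k \<omega>))) \<le> norm (w n k \<omega>)"
          by (simp only: norm_mult norm_fourier[OF p q] mult_1 exp_imaginary_remainder(1)[OF Re_w])
        also have "\<dots> \<le> norm ?u * ?d L1 k + norm ?v * ?d L2 k"
          unfolding w_def by (rule order_trans[OF norm_triangle_ineq]) (use d[of k] in \<open>simp add: norm_mult del: of_real_diff of_nat_Suc\<close>)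
        also have "\<dots> \<le> c * (?d L1 k + ?d L2 k)"
          unfolding c_def using d[of k] by (simp add: distrib_left distrib_right add_increasing del: of_nat_Suc)
        finally show "norm (fourier p q (Z (?t n (Suc k)) \<omega>) * (1 - exp (- w n k \<omega>))) \<le> c * (?d L1 k + ?d L2 k)" .
      qed
      also have "\<dots> = c * ((\<Sum>k<n. ?d L1 k) + (\<Sum>k<n. ?d L2 k))"
        by (simp only: sum_distrib_left[symmetric] sum.distrib)
      also have "\<dots> \<le> c * (L1 1 \<omega> + L2 1 \<omega>)"
      proof (cases "n = 0")
        case True
        then show ?thesis using L1.L_nonneg[OF \<omega>, of 1] L2.L_nonneg[OF \<omega>, of 1] by (simp add: c_def)
      next
        case False
        then have n: "0 < n" by simp
        show ?thesis
          using sum_telescope_grid[OF n, of "\<lambda>t. L1 t \<omega>"] sum_telescope_grid[OF n, of "\<lambda>t. L2 t \<omega>"]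
            L1.L_0[OF \<omega>] L2.L_0[OF \<omega>] by simp
      qed
      finally show "norm (S n \<omega>) \<le> c * (L1 1 \<omega> + L2 1 \<omega>)" .
    qed
  qed measurable
  moreover have "(\<integral>\<omega>. S n \<omega> \<partial>Q) = of_nat n * (1 - exp (?K / of_nat n)) * plane_transform \<pi> p q" for n
  proof -
    have step: "(\<integral>\<omega>. fourier p q (Z (?t n (Suc k)) \<omega>) * (1 - exp (- w n k \<omega>)) \<partial>Q)
        = (1 - exp (?K / of_nat n)) * plane_transform \<pi> p q" if "k < n" for k
    proof -
      have n: "0 < n" using that by simp
      have 1: "integrable Q (\<lambda>\<omega>. fourier p q (Z (?t n (Suc k)) \<omega>))"
        by (rule L1.integrable_const_bound[where B=1]) (simp_all add: norm_fourier[OF p q] del: of_nat_Suc)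
      have 2: "integrable Q (\<lambda>\<omega>. fourier p q (Z (?t n (Suc k)) \<omega>) * exp (- w n k \<omega>))"
        by (rule L1.integrable_const_bound[where B=1])
           (simp_all add: norm_mult norm_fourier[OF p q] Re_w del: of_nat_Suc)
      have "(\<integral>\<omega>. fourier p q (Z (?t n (Suc k)) \<omega>) * (1 - exp (- w n k \<omega>)) \<partial>Q)
          = (\<integral>\<omega>. fourier p q (Z (?t n (Suc k)) \<omega>) \<partial>Q) - (\<integral>\<omega>. fourier p q (Z (?t n (Suc k)) \<omega>) * exp (- w n k \<omega>) \<partial>Q)"
        using 1 2 by (simp add: right_diff_distrib del: of_nat_Suc)
      also have "\<dots> = plane_transform \<pi> p q - exp (of_real (?t n (Suc k) - ?t n k) * ?K) * plane_transform \<pi> p q"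
        unfolding w_def using n
        by (subst plane_transform_eq, simp, subst expectation_fourier_push_removed[OF \<sigma> p q _ _ pq])
           (simp_all add: divide_strict_right_mono)
      also have "of_real (?t n (Suc k) - ?t n k) * ?K = ?K / of_nat n"
        by (simp add: diff_divide_distrib[symmetric])
      finally show ?thesis by (simp add: left_diff_distrib)
    qed
    have "(\<integral>\<omega>. S n \<omega> \<partial>Q) = (\<Sum>k<n. \<integral>\<omega>. fourier p q (Z (?t n (Suc k)) \<omega>) * (1 - exp (- w n k \<omega>)) \<partial>Q)"
      unfolding S_def
    proof (rule Bochner_Integration.integral_sum)
      fix k
      have "norm (fourier p q (Z (?t n (Suc k)) \<omega>) * (1 - exp (- w n k \<omega>))) \<le> 2" for \<omega>
        using norm_triangle_ineq4[of 1 "exp (- w n k \<omega>)"] by (simp add: norm_mult norm_fourier[OF p q] Re_w del: of_nat_Suc)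
      then show "integrable Q (\<lambda>\<omega>. fourier p q (Z (?t n (Suc k)) \<omega>) * (1 - exp (- w n k \<omega>)))"
        by (intro L1.integrable_const_bound[where B=2]) (simp_all del: of_nat_Suc)
    qed
    also have "\<dots> = (\<Sum>k<n. (1 - exp (?K / of_nat n)) * plane_transform \<pi> p q)"
      by (intro sum.cong refl step) simp
    finally show ?thesis by simp
  qed
  ultimately have "(\<lambda>n. of_nat n * (1 - exp (?K / of_nat n)) * plane_transform \<pi> p q)
      \<longlonglongrightarrow> (\<integral>\<omega>. ?u * ?A1 \<omega> + ?v * ?A2 \<omega> \<partial>Q)" by simp
  moreover have "(\<lambda>n. of_nat n * (1 - exp (?K / of_nat n)) * plane_transform \<pi> p q) \<longlonglongrightarrow> - ?K * plane_transform \<pi> p q"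
    by (intro tendsto_mult_right tendsto_n_times_one_minus_exp)
  ultimately have "(\<integral>\<omega>. ?u * ?A1 \<omega> + ?v * ?A2 \<omega> \<partial>Q) = - ?K * plane_transform \<pi> p q"
    by (rule LIMSEQ_unique)
  moreover have "(\<integral>\<omega>. ?u * ?A1 \<omega> + ?v * ?A2 \<omega> \<partial>Q)
      = ?u * line_transform (boundary_measure1 P Z L1 \<pi>) p + ?v * line_transform (boundary_measure2 P Z L2 \<pi>) q"
    unfolding line_transforms[OF int p q]
    using A by simp
  ultimately have "?K * plane_transform \<pi> p q + (?u * line_transform (boundary_measure1 P Z L1 \<pi>) p
      + ?v * line_transform (boundary_measure2 P Z L2 \<pi>) q) = 0" by simp
  then show ?thesis by (simp only: add.assoc)
qed

end

theorem proposition3p1: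
  fixes \<mu>1 \<mu>2 r1 r2 \<sigma>1 \<rho> \<sigma>2 :: real
    and M :: "'a measure"
    and F :: "real \<Rightarrow> 'a measure"
    and P :: "real \<times> real \<Rightarrow> 'a measure"
    and Z W :: "real \<Rightarrow> 'a \<Rightarrow> real \<times> real"
    and L1 L2 :: "real \<Rightarrow> 'a \<Rightarrow> real"
    and \<pi> :: "(real \<times> real) measure"
    and p q :: complex
  assumes "\<sigma>1 > 0" and "\<sigma>2 > 0" and "\<sigma>1 * \<sigma>2 - \<rho>\<^sup>2 > 0"
    and "reflected_brownian_motion \<mu>1 \<mu>2 r1 r2 \<sigma>1 \<rho> \<sigma>2 M F P Z W L1 L2"
    and "positive_recurrent P Z"
    and "\<mu>1 < 0" and "\<mu>2 < 0" and "\<mu>1 - r1 * \<mu>2 > 0" and "\<mu>2 - r2 * \<mu>1 > 0"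
    and "stationary_distribution P Z \<pi>"
    and "\<And>\<pi>'. stationary_distribution P Z \<pi>' \<Longrightarrow> \<pi>' = \<pi>"
    and "Re p = 0" and "Re q = 0"
  shows "kernel_K \<sigma>1 \<rho> \<sigma>2 \<mu>1 \<mu>2 p q * plane_transform \<pi> p q
         + coeff_u r1 p q * line_transform (boundary_measure1 P Z L1 \<pi>) p
         + coeff_v r2 p q * line_transform (boundary_measure2 P Z L2 \<pi>) q = 0"
proof -
  interpret stationary_rbm \<mu>1 \<mu>2 r1 r2 \<sigma>1 \<rho> \<sigma>2 M F P Z W L1 L2 \<pi>
    using assms(4,10) by (intro stationary_rbm.intro stationary_rbm_axioms.intro)
  have "r1 * \<mu>2 < 0" using assms(6,8) by linarith
  then have "0 < r1" using assms(7) by (simp add: mult_less_0_iff)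
  then show ?thesis
    using functional_equation[OF assms(1,3) _ assms(12,13)] by simp
qed

end
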